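(* Assume (A). If $d = \tilde{\omega}\big(\max(n^{3/2}p,\,n)\big)$, then $$\mathsf{TV}\Big(\mathsf{RGG}(n,\mathbb{T}^d,\mathsf{Unif},\sigma^\infty_p,p),\ \mathsf{G}(n,p)\Big) = o(1)\quad\text{as } n\to\infty.$$
   Context: Torus: $\mathbb{T}^d=\mathbb{R}^d/2\mathbb{Z}^d$, i.e. a product of $d$ circles of circumference $2$, with the uniform (Haar) probability measure $\mathsf{Unif}$. For $x,y$ on a circle of circumference 2, $|x-y|_C\in[0,1]$ is the circular distance (length of the shorter arc). For $1\le q<\infty$, $\|\mathbf{x}-\mathbf{y}\|_q=(\sum_{i=1}^d|x_i-y_i|_C^q)^{1/q}$, and $\|\mathbf{x}-\mathbf{y}\|_\infty=\max_i|x_i-y_i|_C$. For $p\in[0,1]$ and $q\in[1,\infty]$, $\tau^q_p$ is the value with $\mathbf{P}_{\mathbf{x},\mathbf{y}\text{ iid }\mathsf{Unif}}[\|\mathbf{x}-\mathbf{y}\|_q\le\tau^q_p]=p$, and $\sigma^q_p(\mathbf{x},\mathbf{y})=\mathbb{1}[\|\mathbf{x}-\mathbf{y}\|_q\le\tau^q_p]$. The random geometric graph $\mathsf{RGG}(n,\mathbb{T}^d,\mathsf{Unif},\sigma^q_p,p)$ on vertex set $[n]$: sample $\mathbf{x}^1,\dots,\mathbf{x}^n$ iid uniform on $\mathbb{T}^d$ and join $i,j$ iff $\|\mathbf{x}^i-\mathbf{x}^j\|_q\le\tau^q_p$. $\mathsf{G}(n,p)$ is the Erdős–Rényi graph. Assumption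 (A): there are absolute constants $\delta,\epsilon>0$ with $n^{-1+\epsilon}\le p\le 1/2$ and $n^\delta\le d$. The notations $\tilde o,\tilde\omega,\tilde O$ hide polylogarithmic factors in $n$. *)

theory Defs
  imports "HOL-Probability.Probability"
begin

text \<open>Circular distance on a circle of circumference 2 (reals taken mod 2).\<close>
definition circ_dist :: "real \<Rightarrow> real \<Rightarrow> real" where
  "circ_dist a b = (let t = 2 * frac ((a - b) / 2) in min t (2 - t))"

text \<open>Points of the torus R^d / 2Z^d: coordinates i < d, representatives in [0,2).\<close>
definition torus_unif :: "nat \<Rightarrow> (nat \<Rightarrow> real) measure" where
  "torus_unif d = PiM {..<d} (\<lambda>_. uniform_measure lborel {0..<2})"

definition linf_dist :: "nat \<Rightarrow> (nat \<Rightarrow> real) \<Rightarrow> (nat \<Rightarrow> real) \<Rightarrow> real" where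
  "linf_dist d x y = Max ({0} \<union> (\<lambda>i. circ_dist (x i) (y i)) ` {..<d})"

definition tau_inf :: "nat \<Rightarrow> real \<Rightarrow> real" where
  "tau_inf d p = (THE t. 0 \<le> t \<and> t \<le> 1 \<and>
      measure (torus_unif d \<Otimes>\<^sub>M torus_unif d)
        {xy \<in> space (torus_unif d \<Otimes>\<^sub>M torus_unif d). linf_dist d (fst xy) (snd xy) \<le> t} = p)"

text \<open>Graphs on vertex set {0..<n}: edge sets of pairs (i,j) with i < j < n.\<close>
definition all_pairs :: "nat \<Rightarrow> (nat \<times> nat) set" where
  "all_pairs n = {(i, j). i < j \<and> j < n}"

definition graphs :: "nat \<Rightarrow> (nat \<times> nat) set set" where
  "graphs n = Pow (all_pairs n)"

definition latent_points :: "nat \<Rightarrow> nat \<Rightarrow> (nat \<Rightarrow> nat \<Rightarrow> real) measure" where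
  "latent_points n d = PiM {..<n} (\<lambda>_. torus_unif d)"

definition rgg_graph :: "nat \<Rightarrow> nat \<Rightarrow> real \<Rightarrow> (nat \<Rightarrow> nat \<Rightarrow> real) \<Rightarrow> (nat \<times> nat) set" where
  "rgg_graph n d t X = {(i, j) \<in> all_pairs n. linf_dist d (X i) (X j) \<le> t}"

definition rgg_prob :: "nat \<Rightarrow> nat \<Rightarrow> real \<Rightarrow> (nat \<times> nat) set \<Rightarrow> real" where
  "rgg_prob n d p E = measure (latent_points n d)
     {X \<in> space (latent_points n d). rgg_graph n d (tau_inf d p) X = E}"

definition gnp_prob :: "nat \<Rightarrow> real \<Rightarrow> (nat \<times> nat) set \<Rightarrow> real" where
  "gnp_prob n p E = p ^ card E * (1 - p) ^ (card (all_pairs n) - card E)"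

definition tv_fin :: "'a set \<Rightarrow> ('a \<Rightarrow> real) \<Rightarrow> ('a \<Rightarrow> real) \<Rightarrow> real" where
  "tv_fin S f g = (1/2) * (\<Sum>x\<in>S. \<bar>f x - g x\<bar>)"

definition tv_rgg_gnp :: "nat \<Rightarrow> nat \<Rightarrow> real \<Rightarrow> real" where
  "tv_rgg_gnp n d p = tv_fin (graphs n) (rgg_prob n d p) (gnp_prob n p)"

end

theory Submission
  imports Defs
begin

text \<open>
  The divergence KL(RGG || G(n,p)) is bounded by revealing the vertices one at a time. Given the
  first k latent points, the chi-square divergence of the next vertex's neighbourhood from k
  independent p-coins averages to E (1 + \<gamma>(z, z') / (p (1 - p)))^k - 1, where
  \<gamma> = m(z, z') - p^2 is the centred probability m(z, z') that a random point is joined to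
  both z and z'. With q = p / (1 - p) this power is (1 - q + q m / p^2)^k, so its mean equals
  E (m / p^2)^B with B binomial(k, q). For the max-distance m is a product over the d coordinates,
  and so is each moment E (m / p^2)^j. On one circle, m / \<tau>^2 has mean 1 and variance O(u^3)
  for u = 1 - \<tau> = 1 - p^(1/d) \<le> ln n / d, hence E (m / p^2)^j \<le> 1 + O(j^2 d u^3) as long as
  n u and n^2 u^3 d are small, which is where d >> n enters. Summing the binomial second moments
  gives KL = O(n^3 p^2 (ln n)^3 / d^2).
\<close>

text \<open>The law of the graph has no usable formula, since its edges depend on each other through
  the labels. Averaging given the labels, which by convexity can only increase the chi-square term,
  leaves just two independent copies z, z' of the new label, and all dependence sits in m(z, z').
  The base 1 - q + q m / p^2 does not factor over coordinates, whereas every power of m does. So the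
  binomial theorem has to come before independence of the coordinates, and p \<le> 1/2 makes q \<le>
  1, so that its weights are nonnegative. As all labels have the same edge density, m / p^2 has mean
  exactly 1: the terms linear in j vanish and only a variance is left. The two terms of the maximum
  have separate origins. The bound n^3 p^2 (ln n)^3 / d^2 is small once d exceeds n^(3/2) p (ln
  n)^(3/2). The term n is the price of linearising the moments for every j < n, although B has mean
  only of order n p.\<close>

section \<open>Total variation and relative entropy\<close>

text \<open>A weak form of Pinsker's inequality, through the Hellinger distance H.\<close>

lemma tv_fin_le_sqrt_kl:
  fixes f g :: "'a \<Rightarrow> real"
  assumes "finite S" and f: "\<And>x. x \<in> S \<Longrightarrow> 0 \<le> f x" and g: "\<And>x. x \<in> S \<Longrightarrow> 0 < g x"
    and sums: "sum f S = 1" "sum g S = 1"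
  shows "tv_fin S f g \<le> sqrt (\<Sum>x\<in>S. f x * ln (f x / g x))"
proof -
  define H where "H = (\<Sum>x\<in>S. (sqrt (f x) - sqrt (g x))\<^sup>2)"
  define K where "K = (\<Sum>x\<in>S. (sqrt (f x) + sqrt (g x))\<^sup>2)"
  \<comment> \<open>The added \<open>g x - f x\<close> sums to 0 over S and makes the inequality
    true term by term. Each term is ln r \<le> r - 1 for r = sqrt (g / f), multiplied by 2
    f.\<close>
  have "H \<le> (\<Sum>x\<in>S. f x * ln (f x / g x) + (g x - f x))"
    unfolding H_def
  proof (rule sum_mono)
    fix x assume x: "x \<in> S"
    show "(sqrt (f x) - sqrt (g x))\<^sup>2 \<le> f x * ln (f x / g x) + (g x - f x)"
    proof (cases "f x = 0")
      case True
      then show ?thesis using g[OF x] by simp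
    next
      case False
      then have fp: "f x > 0" using f[OF x] by simp
      define r where "r = sqrt (g x) / sqrt (f x)"
      have r: "r > 0" unfolding r_def using fp g[OF x] by simp
      have "f x / g x = inverse (r\<^sup>2)"
        unfolding r_def using fp g[OF x] by (simp add: power_divide)
      then have "ln (f x / g x) = - 2 * ln r"
        using r by (simp add: ln_inverse ln_realpow)
      moreover have "ln r \<le> r - 1" using r by (rule ln_le_minus_one)
      ultimately have "ln (f x / g x) \<ge> 2 - 2 * r" by simp
      then have "f x * ln (f x / g x) \<ge> f x * (2 - 2 * r)"
        using fp by (intro mult_left_mono) auto
      moreover have "f x * r = sqrt (f x) * sqrt (g x)"
      proof -
        have "f x * r = f x / sqrt (f x) * sqrt (g x)" by (simp add: r_def)
        then show ?thesis using fp by (simp add: real_div_sqrt)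
      qed
      ultimately show ?thesis using fp g[OF x]
        by (simp add: power2_diff algebra_simps)
    qed
  qed
  also have "\<dots> = (\<Sum>x\<in>S. f x * ln (f x / g x))"
    using sums by (simp add: sum.distrib sum_subtractf)
  finally have H: "H \<le> (\<Sum>x\<in>S. f x * ln (f x / g x))" .
  \<comment> \<open>Cauchy-Schwarz on f - g = (sqrt f - sqrt g)(sqrt f + sqrt g) will produce sqrt K
    \<le> 2, which cancels the 1/2 in \<open>tv_fin\<close>.\<close>
  have "K \<le> (\<Sum>x\<in>S. 2 * f x + 2 * g x)"
    unfolding K_def
  proof (rule sum_mono)
    fix x assume x: "x \<in> S"
    have "0 \<le> (sqrt (f x) - sqrt (g x))\<^sup>2" by simp
    then show "(sqrt (f x) + sqrt (g x))\<^sup>2 \<le> 2 * f x + 2 * g x"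
      using f[OF x] g[OF x] by (simp add: power2_diff power2_sum)
  qed
  also have "\<dots> = 4" using sums by (simp add: sum.distrib flip: sum_distrib_left)
  finally have K: "K \<le> 4" .
  have "(\<Sum>x\<in>S. \<bar>f x - g x\<bar>) = (\<Sum>x\<in>S. \<bar>sqrt (f x) - sqrt (g x)\<bar> * \<bar>sqrt (f x) + sqrt (g x)\<bar>)"
  proof (rule sum.cong[OF refl])
    fix x assume x: "x \<in> S"
    have "f x - g x = (sqrt (f x) - sqrt (g x)) * (sqrt (f x) + sqrt (g x))"
      using f[OF x] g[OF x] by (simp add: algebra_simps)
    then show "\<bar>f x - g x\<bar> = \<bar>sqrt (f x) - sqrt (g x)\<bar> * \<bar>sqrt (f x) + sqrt (g x)\<bar>"
      by (simp add: abs_mult)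
  qed
  also have "\<dots> \<le> L2_set (\<lambda>x. sqrt (f x) - sqrt (g x)) S * L2_set (\<lambda>x. sqrt (f x) + sqrt (g x)) S"
    by (rule L2_set_mult_ineq)
  also have "\<dots> = sqrt H * sqrt K" by (simp add: L2_set_def H_def K_def)
  also have "\<dots> \<le> sqrt (\<Sum>x\<in>S. f x * ln (f x / g x)) * sqrt 4"
  proof -
    have "0 \<le> H" "0 \<le> K" unfolding H_def K_def by (auto intro: sum_nonneg)
    then show ?thesis using H K by (intro mult_mono real_sqrt_le_mono real_sqrt_ge_zero) auto
  qed
  finally show ?thesis unfolding tv_fin_def by simp
qed

text \<open>When the right side is multiplied out, B records the factors that contribute f. This
  normalises the laws of coins, neighbourhoods and graphs, and later turns a sum over neighbourhoods
  into a k-th power.\<close>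

lemma sum_Pow_prod_if:
  fixes f g :: "'a \<Rightarrow> 'b :: comm_semiring_1"
  assumes "finite A"
  shows "(\<Sum>B\<in>Pow A. \<Prod>a\<in>A. if a \<in> B then f a else g a) = (\<Prod>a\<in>A. f a + g a)"
proof -
  have "(\<Prod>a\<in>A. if a \<in> B then f a else g a) = (\<Prod>a\<in>B. f a) * (\<Prod>a\<in>A - B. g a)" if "B \<in> Pow A" for B
    using that assms by (simp add: prod.If_cases Int_absorb1 Diff_eq)
  then show ?thesis using assms by (simp add: prod_add)
qed

lemma (in prob_space) integrable_bounded:
  fixes f :: "'a \<Rightarrow> real"
  assumes "f \<in> borel_measurable M" "\<And>x. x \<in> space M \<Longrightarrow> \<bar>f x\<bar> \<le> B"
  shows "integrable M f"
  using assms by (intro integrable_const_bound[where B = B]) (auto intro: AE_I2)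

section \<open>Graphs grown one vertex at a time\<close>

lemma finite_all_pairs [simp]: "finite (all_pairs n)"
  by (rule finite_subset[of _ "{..<n} \<times> {..<n}"]) (auto simp: all_pairs_def)

lemma finite_graphs [simp]: "finite (graphs n)"
  by (simp add: graphs_def)

lemma all_pairs_Suc: "all_pairs (Suc k) = all_pairs k \<union> (\<lambda>i. (i, k)) ` {..<k}"
  by (auto simp: all_pairs_def less_Suc_eq)

lemma all_pairs_new_disjoint: "all_pairs k \<inter> (\<lambda>i. (i, k)) ` {..<k} = {}"
  by (auto simp: all_pairs_def)

definition add_vertex :: "nat \<Rightarrow> (nat \<times> nat) set \<Rightarrow> nat set \<Rightarrow> (nat \<times> nat) set" where
  "add_vertex k E S = E \<union> (\<lambda>i. (i, k)) ` S"

lemma sum_graphs_Suc: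
  "(\<Sum>G\<in>graphs (Suc k). h G) = (\<Sum>E\<in>graphs k. \<Sum>S\<in>Pow {..<k}. h (add_vertex k E S))"
proof -
  have "bij_betw (\<lambda>(E, S). add_vertex k E S) (graphs k \<times> Pow {..<k}) (graphs (Suc k))"
  proof (rule bij_betw_byWitness[where f' = "\<lambda>G. (G \<inter> all_pairs k, {i. (i, k) \<in> G})"])
    show "\<forall>a\<in>graphs k \<times> Pow {..<k}. (\<lambda>G. (G \<inter> all_pairs k, {i. (i, k) \<in> G})) (case a of (E, S) \<Rightarrow> add_vertex k E S) = a"
      by (auto simp: graphs_def all_pairs_def add_vertex_def)
    show "\<forall>a'\<in>graphs (Suc k). (case (a' \<inter> all_pairs k, {i. (i, k) \<in> a'}) of (E, S) \<Rightarrow> add_vertex k E S) = a'"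
      by (fastforce simp: graphs_def all_pairs_def add_vertex_def less_Suc_eq)
    show "(\<lambda>(E, S). add_vertex k E S) ` (graphs k \<times> Pow {..<k}) \<subseteq> graphs (Suc k)"
      by (auto simp: graphs_def all_pairs_Suc add_vertex_def)
    show "(\<lambda>G. (G \<inter> all_pairs k, {i. (i, k) \<in> G})) ` graphs (Suc k) \<subseteq> graphs k \<times> Pow {..<k}"
      by (auto simp: graphs_def all_pairs_def)
  qed
  from sum.reindex_bij_betw[OF this, of h] show ?thesis
    by (simp add: sum.cartesian_product split_def)
qed

lemma prod_all_pairs_add_vertex:
  assumes "E \<in> graphs k"
  shows "(\<Prod>e\<in>all_pairs (Suc k). if e \<in> add_vertex k E S then f e else g e) =
    (\<Prod>e\<in>all_pairs k. if e \<in> E then f e else g e) *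
    (\<Prod>i<k. if i \<in> S then f (i, k) else (g (i, k) :: real))"
proof -
  have "(\<Prod>e\<in>all_pairs k. if e \<in> add_vertex k E S then f e else g e) =
      (\<Prod>e\<in>all_pairs k. if e \<in> E then f e else g e)"
    by (rule prod.cong) (auto simp: add_vertex_def all_pairs_def)
  moreover have "(\<Prod>e\<in>(\<lambda>i. (i, k)) ` {..<k}. if e \<in> add_vertex k E S then f e else g e) =
      (\<Prod>i<k. if i \<in> S then f (i, k) else g (i, k))"
    using assms by (subst prod.reindex)
      (auto simp: inj_on_def add_vertex_def graphs_def all_pairs_def intro!: prod.cong)
  ultimately show ?thesis
    unfolding all_pairs_Suc using all_pairs_new_disjoint
    by (subst prod.union_disjoint) auto
qed

lemma gnp_prob_eq_prod:
  assumes "E \<in> graphs n"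
  shows "gnp_prob n p E = (\<Prod>e\<in>all_pairs n. if e \<in> E then p else 1 - p)"
proof -
  have "E \<subseteq> all_pairs n" using assms by (simp add: graphs_def)
  then show ?thesis
    by (simp add: gnp_prob_def prod.If_cases Int_absorb1 card_Diff_subset finite_subset
        flip: Diff_eq)
qed

lemma sum_gnp_prob: "(\<Sum>E\<in>graphs n. gnp_prob n p E) = 1"
  using sum_Pow_prod_if[of "all_pairs n" "\<lambda>_. p" "\<lambda>_. 1 - p"]
  by (simp add: gnp_prob_eq_prod cong: sum.cong) (simp add: graphs_def)

lemma gnp_prob_pos: "0 < p \<Longrightarrow> p < 1 \<Longrightarrow> 0 < gnp_prob n p E"
  by (simp add: gnp_prob_def)

section \<open>Relative entropy of latent space graphs\<close>

text \<open>All integrands below are bounded functions of two independent points, so boundedness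
  alone licenses Fubini. The curried form matches the iterated integrals in which the codegree
  moments are written.\<close>

lemma pair_prob_integral:
  fixes f :: "'a \<Rightarrow> 'b \<Rightarrow> real"
  assumes "prob_space M" "prob_space N"
    and f: "case_prod f \<in> borel_measurable (M \<Otimes>\<^sub>M N)"
    and B: "\<And>x y. x \<in> space M \<Longrightarrow> y \<in> space N \<Longrightarrow> \<bar>f x y\<bar> \<le> B"
  shows integrable_pair_bounded: "integrable (M \<Otimes>\<^sub>M N) (case_prod f)"
    and iterated_integral_eq_pair: "(\<integral>x. (\<integral>y. f x y \<partial>N) \<partial>M) = (\<integral>z. case_prod f z \<partial>(M \<Otimes>\<^sub>M N))"
    and iterated_integral_swap: "(\<integral>x. (\<integral>y. f x y \<partial>N) \<partial>M) = (\<integral>y. (\<integral>x. f x y \<partial>M) \<partial>N)"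
proof -
  interpret M: prob_space M by fact
  interpret N: prob_space N by fact
  interpret MN: pair_prob_space M N ..
  show i: "integrable (M \<Otimes>\<^sub>M N) (case_prod f)"
    using f B by (intro MN.integrable_bounded[where B = B]) (auto simp: space_pair_measure)
  show "(\<integral>x. (\<integral>y. f x y \<partial>N) \<partial>M) = (\<integral>z. case_prod f z \<partial>(M \<Otimes>\<^sub>M N))"
    by (rule MN.integral_fst[OF i])
  show "(\<integral>x. (\<integral>y. f x y \<partial>N) \<partial>M) = (\<integral>y. (\<integral>x. f x y \<partial>M) \<partial>N)"
    by (rule MN.Fubini_integral[OF i, symmetric])
qed

lemma (in prob_space) integral_unit_interval:
  fixes f :: "'a \<Rightarrow> real"
  assumes "f \<in> borel_measurable M" "\<And>x. x \<in> space M \<Longrightarrow> 0 \<le> f x \<and> f x \<le> 1"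
  shows "0 \<le> (\<integral>x. f x \<partial>M)" "(\<integral>x. f x \<partial>M) \<le> 1"
proof -
  have "integrable M f" using assms by (intro integrable_bounded[where B = 1]) auto
  then show "(\<integral>x. f x \<partial>M) \<le> 1" using assms
    by (intro integral_le_const) (auto intro: AE_I2)
  show "0 \<le> (\<integral>x. f x \<partial>M)" using assms by (intro Bochner_Integration.integral_nonneg) auto
qed

lemma prod_unit_interval:
  fixes f :: "'a \<Rightarrow> real"
  assumes "\<And>i. i \<in> A \<Longrightarrow> 0 \<le> f i \<and> f i \<le> 1"
  shows "0 \<le> prod f A" "prod f A \<le> 1"
  using assms by (auto intro: prod_nonneg prod_le_1)

text \<open>
  Each point has an iid label with law M, and points labelled x, y are joined with probability
  s x y; p is the resulting edge density, which is required to be the same at every label.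
\<close>

locale latent_kernel = prob_space M for M :: "'a measure" +
  fixes s :: "'a \<Rightarrow> 'a \<Rightarrow> real" and p :: real
  assumes s_pair_measurable: "case_prod s \<in> borel_measurable (M \<Otimes>\<^sub>M M)"
    and s_nonneg [simp]: "0 \<le> s x y" and s_le_1 [simp]: "s x y \<le> 1"
    and s_sym: "s x y = s y x"
    and s_mean: "z \<in> space M \<Longrightarrow> (\<integral>x. s x z \<partial>M) = p"
begin

lemma s_measurable [measurable (raw)]:
  assumes "f \<in> measurable N M" "g \<in> measurable N M"
  shows "(\<lambda>w. s (f w) (g w)) \<in> borel_measurable N"
  using measurable_compose[OF measurable_Pair[OF assms] s_pair_measurable] by simp

text \<open>The function m(z, z') of the overview.\<close>

definition codegree :: "'a \<Rightarrow> 'a \<Rightarrow> real" where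
  "codegree z z' = (\<integral>x. s x z * s x z' \<partial>M)"

lemma codegree_measurable [measurable (raw)]:
  assumes [measurable]: "f \<in> measurable N M" "g \<in> measurable N M"
  shows "(\<lambda>w. codegree (f w) (g w)) \<in> borel_measurable N"
  unfolding codegree_def by measurable

lemma codegree_bounds:
  assumes [measurable]: "z \<in> space M" "z' \<in> space M"
  shows "0 \<le> codegree z z'" "codegree z z' \<le> 1"
  unfolding codegree_def using integral_unit_interval[of "\<lambda>x. s x z * s x z'"]
  by (auto simp: mult_le_one)

lemma integrable_s [simp]: "z \<in> space M \<Longrightarrow> integrable M (\<lambda>x. s x z)"
  by (rule integrable_bounded[where B = 1]) auto

lemma integrable_s_mult [simp]:
  assumes [measurable]: "z \<in> space M" "z' \<in> space M"
  shows "integrable M (\<lambda>x. s x z * s x z')"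
  by (rule integrable_bounded[where B = 1]) (auto simp: abs_mult mult_le_one)

text \<open>Inclusion-exclusion. Since the density is the same at z and z', the chance of missing
  both depends on the codegree alone.\<close>

lemma integral_compl_mult:
  assumes "z \<in> space M" "z' \<in> space M"
  shows "(\<integral>x. (1 - s x z) * (1 - s x z') \<partial>M) = 1 - 2 * p + codegree z z'"
proof -
  have "(\<integral>x. (1 - s x z) * (1 - s x z') \<partial>M) = (\<integral>x. 1 - s x z - s x z' + s x z * s x z' \<partial>M)"
    by (simp add: algebra_simps)
  also have "\<dots> = 1 - 2 * p + codegree z z'"
    using assms by (simp add: codegree_def s_mean prob_space)
  finally show ?thesis .
qed

section \<open>Neighbourhoods and graphs with given labels\<close>

sublocale vertices: product_prob_space "\<lambda>_ :: nat. M" UNIV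
  by unfold_locales

lemma prob_space_points: "prob_space (PiM {..<k :: nat} (\<lambda>_. M))"
  by (rule prob_space_PiM) (rule prob_space_axioms)

text \<open>Edges are independent given the labels, so this is the conditional probability that a
  vertex labelled z is joined to exactly the vertices in S. \<open>nbr_prob\<close> averages it over
  z, and \<open>graph_weight\<close> is its analogue for a whole graph.\<close>

definition nbr_weight :: "nat \<Rightarrow> nat set \<Rightarrow> (nat \<Rightarrow> 'a) \<Rightarrow> 'a \<Rightarrow> real" where
  "nbr_weight k S X z = (\<Prod>i<k. if i \<in> S then s (X i) z else 1 - s (X i) z)"

definition nbr_prob :: "nat \<Rightarrow> nat set \<Rightarrow> (nat \<Rightarrow> 'a) \<Rightarrow> real" where
  "nbr_prob k S X = (\<integral>z. nbr_weight k S X z \<partial>M)"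

definition graph_weight :: "nat \<Rightarrow> (nat \<times> nat) set \<Rightarrow> (nat \<Rightarrow> 'a) \<Rightarrow> real" where
  "graph_weight k E X = (\<Prod>e\<in>all_pairs k.
     if e \<in> E then s (X (fst e)) (X (snd e)) else 1 - s (X (fst e)) (X (snd e)))"

definition graph_prob :: "nat \<Rightarrow> (nat \<times> nat) set \<Rightarrow> real" where
  "graph_prob k E = (\<integral>X. graph_weight k E X \<partial>PiM {..<k} (\<lambda>_. M))"

lemma nbr_weight_bounds [simp]: "0 \<le> nbr_weight k S X z" "nbr_weight k S X z \<le> 1"
  unfolding nbr_weight_def by (rule prod_unit_interval; simp)+

lemma graph_weight_bounds [simp]: "0 \<le> graph_weight k E X" "graph_weight k E X \<le> 1"
  unfolding graph_weight_def by (rule prod_unit_interval; simp)+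

lemma nbr_weight_measurable [measurable (raw)]:
  assumes [measurable]: "f \<in> measurable N (PiM {..<k} (\<lambda>_. M))" "g \<in> measurable N M"
  shows "(\<lambda>w. nbr_weight k S (f w) (g w)) \<in> borel_measurable N"
  unfolding nbr_weight_def by measurable

lemma graph_weight_measurable [measurable]:
  "graph_weight k E \<in> borel_measurable (PiM {..<k} (\<lambda>_. M))"
proof -
  have "(\<lambda>X. if e \<in> E then s (X (fst e)) (X (snd e)) else 1 - s (X (fst e)) (X (snd e)))
      \<in> borel_measurable (PiM {..<k} (\<lambda>_. M))" if "e \<in> all_pairs k" for e
  proof -
    have [measurable]: "fst e \<in> {..<k}" "snd e \<in> {..<k}" using that by (auto simp: all_pairs_def)
    show ?thesis by measurable
  qed
  then show ?thesis unfolding graph_weight_def by (intro borel_measurable_prod)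
qed

lemma nbr_prob_measurable [measurable]:
  "nbr_prob k S \<in> borel_measurable (PiM {..<k} (\<lambda>_. M))"
  unfolding nbr_prob_def by measurable

lemma nbr_weight_measurable_point [measurable]:
  assumes "X \<in> space (PiM {..<k} (\<lambda>_. M))"
  shows "nbr_weight k S X \<in> borel_measurable M"
  using assms by measurable

lemma nbr_prob_bounds:
  assumes "X \<in> space (PiM {..<k} (\<lambda>_. M))"
  shows "0 \<le> nbr_prob k S X" "nbr_prob k S X \<le> 1"
  unfolding nbr_prob_def using integral_unit_interval[of "nbr_weight k S X"] assms by auto

lemma integrable_nbr_weight [simp]:
  assumes "X \<in> space (PiM {..<k} (\<lambda>_. M))"
  shows "integrable M (nbr_weight k S X)"
  using assms by (intro integrable_bounded[where B = 1]) auto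

lemma integrable_graph_weight_mult:
  assumes [measurable]: "f \<in> borel_measurable (PiM {..<k} (\<lambda>_. M))"
    and f: "\<And>X. X \<in> space (PiM {..<k} (\<lambda>_. M)) \<Longrightarrow> 0 \<le> f X \<and> f X \<le> 1"
  shows "integrable (PiM {..<k} (\<lambda>_. M)) (\<lambda>X. graph_weight k E X * f X)"
proof -
  interpret P: prob_space "PiM {..<k} (\<lambda>_. M)" by (rule prob_space_points)
  show ?thesis
    by (rule P.integrable_bounded[where B = 1]) (auto simp: abs_mult f intro!: mult_le_one)
qed

lemma sum_nbr_weight: "(\<Sum>S\<in>Pow {..<k}. nbr_weight k S X z) = 1"
  unfolding nbr_weight_def by (subst sum_Pow_prod_if) auto

lemma sum_graph_weight: "(\<Sum>E\<in>graphs k. graph_weight k E X) = 1"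
  unfolding graph_weight_def graphs_def by (subst sum_Pow_prod_if) auto

lemma sum_nbr_prob:
  assumes "X \<in> space (PiM {..<k} (\<lambda>_. M))"
  shows "(\<Sum>S\<in>Pow {..<k}. nbr_prob k S X) = 1"
proof -
  have "(\<Sum>S\<in>Pow {..<k}. nbr_prob k S X) = (\<integral>z. (\<Sum>S\<in>Pow {..<k}. nbr_weight k S X z) \<partial>M)"
    unfolding nbr_prob_def using assms by (intro Bochner_Integration.integral_sum[symmetric]) auto
  then show ?thesis by (simp add: sum_nbr_weight prob_space)
qed

lemma graph_prob_nonneg: "0 \<le> graph_prob k E"
  unfolding graph_prob_def by (intro Bochner_Integration.integral_nonneg) auto

lemma sum_graph_prob: "(\<Sum>E\<in>graphs k. graph_prob k E) = 1"
proof -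
  interpret P: prob_space "PiM {..<k} (\<lambda>_. M)" by (rule prob_space_points)
  have "(\<Sum>E\<in>graphs k. graph_prob k E) =
      (\<integral>X. (\<Sum>E\<in>graphs k. graph_weight k E X) \<partial>PiM {..<k} (\<lambda>_. M))"
    unfolding graph_prob_def using integrable_graph_weight_mult[of "\<lambda>_. 1" k]
    by (intro Bochner_Integration.integral_sum[symmetric]) auto
  then show ?thesis by (simp add: sum_graph_weight P.prob_space)
qed

text \<open>Edges among the first k vertices do not see the label of vertex k. Integrating that
  label out first therefore acts only on the new factors.\<close>

lemma graph_prob_add_vertex:
  assumes E: "E \<in> graphs k"
  shows "graph_prob (Suc k) (add_vertex k E S) =
    (\<integral>X. graph_weight k E X * nbr_prob k S X \<partial>PiM {..<k} (\<lambda>_. M))"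
proof -
  interpret P: prob_space "PiM {..<Suc k} (\<lambda>_. M)" by (rule prob_space_points)
  have int: "integrable (PiM {..<Suc k} (\<lambda>_. M)) (graph_weight (Suc k) (add_vertex k E S))"
    by (rule P.integrable_bounded[where B = 1]) auto
  have *: "graph_weight (Suc k) (add_vertex k E S) (X(k := z)) =
      graph_weight k E X * nbr_weight k S X z" for X z
  proof -
    have old: "(\<Prod>e\<in>all_pairs k. if e \<in> E then s ((X(k := z)) (fst e)) ((X(k := z)) (snd e))
          else 1 - s ((X(k := z)) (fst e)) ((X(k := z)) (snd e))) = graph_weight k E X"
      unfolding graph_weight_def by (rule prod.cong) (auto simp: all_pairs_def)
    show ?thesis
      unfolding graph_weight_def[of "Suc k"] prod_all_pairs_add_vertex[OF E] old
      by (auto simp: nbr_weight_def intro!: prod.cong)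
  qed
  have "graph_prob (Suc k) (add_vertex k E S) =
      (\<integral>X. (\<integral>z. graph_weight (Suc k) (add_vertex k E S) (X(k := z)) \<partial>M) \<partial>PiM {..<k} (\<lambda>_. M))"
    unfolding graph_prob_def
    using vertices.product_integral_insert[of "{..<k}" k "graph_weight (Suc k) (add_vertex k E S)"] int
    by (simp add: lessThan_Suc)
  then show ?thesis by (simp add: * nbr_prob_def)
qed

text \<open>The square of an integral over z is an integral over two independent copies z, z'. With
  these fixed, the labels \<open>X i\<close> are independent, so the product splits into one-vertex
  integrals, each determined by the codegree.\<close>

lemma integral_nbr_prob_square:
  "(\<integral>X. (nbr_prob k S X)\<^sup>2 \<partial>PiM {..<k} (\<lambda>_. M)) =
    (\<integral>z. (\<integral>z'. (\<Prod>i<k. if i \<in> S then codegree z z' else 1 - 2 * p + codegree z z') \<partial>M) \<partial>M)"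
proof -
  let ?P = "PiM {..<k} (\<lambda>_. M)"
  interpret P: prob_space ?P by (rule prob_space_points)
  have b: "\<bar>nbr_weight k S X z * nbr_weight k S X z'\<bar> \<le> 1" for X z z'
    by (auto simp: abs_mult intro!: mult_le_one)
  have "(\<integral>X. (nbr_prob k S X)\<^sup>2 \<partial>?P) =
      (\<integral>X. (\<integral>z. (\<integral>z'. nbr_weight k S X z * nbr_weight k S X z' \<partial>M) \<partial>M) \<partial>?P)"
    by (simp add: nbr_prob_def power2_eq_square)
  also have "\<dots> = (\<integral>z. (\<integral>X. (\<integral>z'. nbr_weight k S X z * nbr_weight k S X z' \<partial>M) \<partial>?P) \<partial>M)"
  proof (rule iterated_integral_swap[where B = 1])
    show "case_prod (\<lambda>X z. \<integral>z'. nbr_weight k S X z * nbr_weight k S X z' \<partial>M) \<in> borel_measurable (?P \<Otimes>\<^sub>M M)"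
      by measurable
    fix X z assume X: "X \<in> space ?P" "z \<in> space M"
    show "\<bar>\<integral>z'. nbr_weight k S X z * nbr_weight k S X z' \<partial>M\<bar> \<le> 1"
      using nbr_prob_bounds[OF X(1), of S] by (auto simp: abs_mult nbr_prob_def intro!: mult_le_one)
  qed (unfold_locales)
  also have "\<dots> = (\<integral>z. (\<integral>z'. (\<integral>X. nbr_weight k S X z * nbr_weight k S X z' \<partial>?P) \<partial>M) \<partial>M)"
    by (intro Bochner_Integration.integral_cong refl iterated_integral_swap[where B = 1] b)
      (unfold_locales, measurable)
  also have "\<dots> = (\<integral>z. (\<integral>z'. (\<Prod>i<k. if i \<in> S then codegree z z' else 1 - 2 * p + codegree z z') \<partial>M) \<partial>M)"
  proof (intro Bochner_Integration.integral_cong refl)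
    fix z z' assume z [measurable]: "z \<in> space M" "z' \<in> space M"
    let ?f = "\<lambda>i x. (if i \<in> S then s x z else 1 - s x z) * (if i \<in> S then s x z' else 1 - s x z')"
    have "(\<integral>X. nbr_weight k S X z * nbr_weight k S X z' \<partial>?P) = (\<integral>X. (\<Prod>i<k. ?f i (X i)) \<partial>?P)"
      by (simp add: nbr_weight_def prod.distrib)
    also have "\<dots> = (\<Prod>i<k. \<integral>x. ?f i x \<partial>M)"
      by (intro vertices.product_integral_prod integrable_bounded[where B = 1])
        (auto simp: abs_mult intro!: mult_le_one)
    also have "\<dots> = (\<Prod>i<k. if i \<in> S then codegree z z' else 1 - 2 * p + codegree z z')"
      using integral_compl_mult[OF z] by (intro prod.cong) (auto simp: codegree_def)
    finally show "(\<integral>X. nbr_weight k S X z * nbr_weight k S X z' \<partial>?P) =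
      (\<Prod>i<k. if i \<in> S then codegree z z' else 1 - 2 * p + codegree z z')" .
  qed
  finally show ?thesis .
qed

lemma codegree_compl_bounds:
  assumes [measurable]: "z \<in> space M" "z' \<in> space M"
  shows "0 \<le> 1 - 2 * p + codegree z z'" "1 - 2 * p + codegree z z' \<le> 1"
  unfolding integral_compl_mult[OF assms, symmetric]
  using integral_unit_interval[of "\<lambda>x. (1 - s x z) * (1 - s x z')"] by (auto simp: mult_le_one)

text \<open>Jensen's inequality for the law of the labels conditioned on the graph E: the ratio a /
  b in the proof is the mean of \<open>nbr_prob k S\<close> under that law, and its variance is
  nonnegative. This trades conditioning on the graph for conditioning on the labels.\<close>

lemma graph_prob_add_vertex_square:
  assumes E: "E \<in> graphs k" and pos: "graph_prob k E > 0"
  shows "(graph_prob (Suc k) (add_vertex k E S))\<^sup>2 / graph_prob k E \<le>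
    (\<integral>X. graph_weight k E X * (nbr_prob k S X)\<^sup>2 \<partial>PiM {..<k} (\<lambda>_. M))"
proof -
  let ?P = "PiM {..<k} (\<lambda>_. M)"
  define a where "a = graph_prob (Suc k) (add_vertex k E S)"
  define b where "b = graph_prob k E"
  have "integrable ?P (\<lambda>X. graph_weight k E X * 1)"
    by (rule integrable_graph_weight_mult) auto
  then have i0: "integrable ?P (graph_weight k E)" by simp
  have i1: "integrable ?P (\<lambda>X. graph_weight k E X * nbr_prob k S X)"
    by (rule integrable_graph_weight_mult) (use nbr_prob_bounds in auto)
  have i2: "integrable ?P (\<lambda>X. graph_weight k E X * (nbr_prob k S X)\<^sup>2)"
    by (rule integrable_graph_weight_mult) (use nbr_prob_bounds in \<open>auto simp: power_le_one\<close>)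
  have "0 \<le> (\<integral>X. graph_weight k E X * (nbr_prob k S X - a / b)\<^sup>2 \<partial>?P)"
    by (intro Bochner_Integration.integral_nonneg) auto
  also have "\<dots> = (\<integral>X. graph_weight k E X * (nbr_prob k S X)\<^sup>2
      - 2 * (a / b) * (graph_weight k E X * nbr_prob k S X) + (a / b)\<^sup>2 * graph_weight k E X \<partial>?P)"
    by (intro Bochner_Integration.integral_cong) (auto simp: power2_diff algebra_simps)
  also have "\<dots> = (\<integral>X. graph_weight k E X * (nbr_prob k S X)\<^sup>2 \<partial>?P) - 2 * (a / b) * a + (a / b)\<^sup>2 * b"
  proof -
    have "(\<integral>X. graph_weight k E X * nbr_prob k S X \<partial>?P) = a"
      by (simp add: a_def graph_prob_add_vertex[OF E])
    moreover have "(\<integral>X. graph_weight k E X \<partial>?P) = b"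
      by (simp add: b_def graph_prob_def)
    ultimately show ?thesis using i0 i1 i2 by simp
  qed
  also have "\<dots> = (\<integral>X. graph_weight k E X * (nbr_prob k S X)\<^sup>2 \<partial>?P) - a\<^sup>2 / b"
    using pos by (simp add: b_def[symmetric] power2_eq_square field_simps)
  finally show ?thesis by (simp add: a_def b_def)
qed

text \<open>For 0 < p < 1 the base equals 1 + (m - p^2) / (p (1 - p)). Its two summands come from
  the presence and the absence of one edge.\<close>

definition codegree_moment :: "nat \<Rightarrow> real" where
  "codegree_moment k =
     (\<integral>z. (\<integral>z'. (codegree z z' / p + (1 - 2 * p + codegree z z') / (1 - p)) ^ k \<partial>M) \<partial>M)"

text \<open>The left side is one plus the chi-square divergence of the new neighbourhood from k
  coins, averaged over the labels. Dividing by the coin weights factor by factor and summing over S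
  multiplies out to the k-th power.\<close>

lemma sum_integral_nbr_prob_square:
  assumes p: "0 < p" "p < 1"
  shows "(\<Sum>S\<in>Pow {..<k}. (\<integral>X. (nbr_prob k S X)\<^sup>2 \<partial>PiM {..<k} (\<lambda>_. M)) /
    (\<Prod>i<k. if i \<in> S then p else 1 - p)) = codegree_moment k"
proof -
  let ?w = "\<lambda>S. \<Prod>i<k. if i \<in> S then p else 1 - p"
  let ?F = "\<lambda>S z z'. \<Prod>i<k. if i \<in> S then codegree z z' else 1 - 2 * p + codegree z z'"
  have F: "case_prod (?F S) \<in> borel_measurable (M \<Otimes>\<^sub>M M)" for S by measurable
  have b: "\<bar>?F S z z'\<bar> \<le> 1" if "z \<in> space M" "z' \<in> space M" for S z z'
  proof -
    have "0 \<le> ?F S z z'" "?F S z z' \<le> 1"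
      by (rule prod_unit_interval; use that codegree_bounds codegree_compl_bounds in auto)+
    then show ?thesis by simp
  qed
  have int: "integrable (M \<Otimes>\<^sub>M M) (case_prod (?F S))" for S
    by (rule integrable_pair_bounded[OF prob_space_axioms prob_space_axioms F b])
  have sum: "(\<Sum>S\<in>Pow {..<k}. ?F S z z' / ?w S) =
      (codegree z z' / p + (1 - 2 * p + codegree z z') / (1 - p)) ^ k" for z z'
  proof -
    have "(\<Sum>S\<in>Pow {..<k}. ?F S z z' / ?w S) =
        (\<Sum>S\<in>Pow {..<k}. \<Prod>i<k. if i \<in> S then codegree z z' / p else (1 - 2 * p + codegree z z') / (1 - p))"
      by (intro sum.cong refl) (auto simp flip: prod_dividef intro!: prod.cong)
    then show ?thesis by (simp add: sum_Pow_prod_if)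
  qed
  have "(\<Sum>S\<in>Pow {..<k}. (\<integral>X. (nbr_prob k S X)\<^sup>2 \<partial>PiM {..<k} (\<lambda>_. M)) / ?w S) =
      (\<Sum>S\<in>Pow {..<k}. \<integral>zz. case_prod (?F S) zz / ?w S \<partial>(M \<Otimes>\<^sub>M M))"
    by (intro sum.cong refl) (simp add: integral_nbr_prob_square
        iterated_integral_eq_pair[OF prob_space_axioms prob_space_axioms F b])
  also have "\<dots> = (\<integral>zz. (\<Sum>S\<in>Pow {..<k}. case_prod (?F S) zz / ?w S) \<partial>(M \<Otimes>\<^sub>M M))"
    by (intro Bochner_Integration.integral_sum[symmetric] integrable_divide int)
  also have "\<dots> = (\<integral>zz. case_prod (\<lambda>z z'. \<Sum>S\<in>Pow {..<k}. ?F S z z' / ?w S) zz \<partial>(M \<Otimes>\<^sub>M M))"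
    by (intro Bochner_Integration.integral_cong) auto
  also have "\<dots> = (\<integral>z. (\<integral>z'. (\<Sum>S\<in>Pow {..<k}. ?F S z z' / ?w S) \<partial>M) \<partial>M)"
  proof (rule iterated_integral_eq_pair[symmetric])
    show "case_prod (\<lambda>z z'. \<Sum>S\<in>Pow {..<k}. ?F S z z' / ?w S) \<in> borel_measurable (M \<Otimes>\<^sub>M M)"
      by measurable
    fix z z' assume z: "z \<in> space M" "z' \<in> space M"
    \<comment> \<open>A crude bound suffices: it only has to be finite and independent of z and
      z'.\<close>
    have "\<bar>\<Sum>S\<in>Pow {..<k}. ?F S z z' / ?w S\<bar> \<le> (\<Sum>S\<in>Pow {..<k}. \<bar>?F S z z' / ?w S\<bar>)"
      by (rule sum_abs)
    also have "\<dots> \<le> (\<Sum>S\<in>Pow {..<k}. 1 / \<bar>?w S\<bar>)"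
      using b[OF z] by (intro sum_mono) (simp add: abs_divide divide_right_mono del: abs_prod)
    finally show "\<bar>\<Sum>S\<in>Pow {..<k}. ?F S z z' / ?w S\<bar> \<le> (\<Sum>S\<in>Pow {..<k}. 1 / \<bar>?w S\<bar>)" .
  qed (rule prob_space_axioms)+
  finally show ?thesis by (simp add: sum codegree_moment_def)
qed

section \<open>Relative entropy and its chain rule\<close>

definition graph_kl :: "nat \<Rightarrow> real" where
  "graph_kl k = (\<Sum>E\<in>graphs k. graph_prob k E * ln (graph_prob k E / gnp_prob k p E))"

text \<open>The chain rule splits the logarithm into a part for the old graph and a part for the new
  neighbourhood given the old graph. Applying ln x \<le> x - 1 to the latter bounds its relative
  entropy by a chi-square divergence.\<close>

lemma graph_kl_Suc:
  assumes p: "0 < p" "p < 1"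
  shows "graph_kl (Suc k) \<le> graph_kl k + (codegree_moment k - 1)"
proof -
  let ?P = "PiM {..<k} (\<lambda>_. M)"
  let ?a = "\<lambda>E S. graph_prob (Suc k) (add_vertex k E S)"
  let ?b = "graph_prob k"
  let ?w = "\<lambda>S. \<Prod>i<k. if i \<in> S then p else 1 - p"
  let ?J = "\<lambda>E S. \<integral>X. graph_weight k E X * (nbr_prob k S X)\<^sup>2 \<partial>?P"
  have w: "?w S > 0" for S using p by (intro prod_pos) auto
  have a0: "?a E S \<ge> 0" for E S by (rule graph_prob_nonneg)
  have J0: "?J E S \<ge> 0" for E S by (intro Bochner_Integration.integral_nonneg) auto
  have i1: "integrable ?P (\<lambda>X. graph_weight k E X * nbr_prob k S X)" for E S
    by (rule integrable_graph_weight_mult) (use nbr_prob_bounds in auto)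
  have i2: "integrable ?P (\<lambda>X. graph_weight k E X * (nbr_prob k S X)\<^sup>2)" for E S
    by (rule integrable_graph_weight_mult) (use nbr_prob_bounds in \<open>auto simp: power_le_one\<close>)
  have marginal: "(\<Sum>S\<in>Pow {..<k}. ?a E S) = ?b E" if E: "E \<in> graphs k" for E
  proof -
    have "(\<Sum>S\<in>Pow {..<k}. ?a E S) = (\<integral>X. (\<Sum>S\<in>Pow {..<k}. graph_weight k E X * nbr_prob k S X) \<partial>?P)"
      unfolding graph_prob_add_vertex[OF E] using i1
      by (intro Bochner_Integration.integral_sum[symmetric])
    also have "\<dots> = (\<integral>X. graph_weight k E X \<partial>?P)"
      by (intro Bochner_Integration.integral_cong) (auto simp: sum_nbr_prob simp flip: sum_distrib_left)
    finally show ?thesis by (simp add: graph_prob_def)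
  qed
  have step: "?a E S * ln (?a E S / gnp_prob (Suc k) p (add_vertex k E S)) \<le>
      ?a E S * ln (?b E / gnp_prob k p E) + ?J E S / ?w S - ?a E S"
    if E: "E \<in> graphs k" and S: "S \<in> Pow {..<k}" for E S
  \<comment> \<open>In the null case the product with the logarithm is 0, whatever value
    \<open>ln 0\<close> has.\<close>
  proof (cases "?a E S = 0")
    case True
    then show ?thesis using J0[of E S] w[of S] by simp
  next
    case False
    then have a: "?a E S > 0" using a0[of E S] by simp
    have "?a E S \<le> ?b E"
      unfolding marginal[OF E, symmetric] using S a0 by (intro member_le_sum) auto
    then have b: "?b E > 0" using a by simp
    have Q: "gnp_prob k p E > 0" using p by (rule gnp_prob_pos)
    have "add_vertex k E S \<in> graphs (Suc k)"
      using E S by (auto simp: add_vertex_def graphs_def all_pairs_Suc)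
    then have "gnp_prob (Suc k) p (add_vertex k E S) = gnp_prob k p E * ?w S"
      using prod_all_pairs_add_vertex[OF E, of S "\<lambda>_. p" "\<lambda>_. 1 - p"] E by (simp add: gnp_prob_eq_prod)
    then have "?a E S / gnp_prob (Suc k) p (add_vertex k E S) =
        (?b E / gnp_prob k p E) * (?a E S / (?b E * ?w S))"
      using b by simp
    then have "ln (?a E S / gnp_prob (Suc k) p (add_vertex k E S)) =
        ln (?b E / gnp_prob k p E) + ln (?a E S / (?b E * ?w S))"
      using a b w[of S] Q by (simp only:) (subst ln_mult_pos; simp)
    also have "\<dots> \<le> ln (?b E / gnp_prob k p E) + (?a E S / (?b E * ?w S) - 1)"
      using a b w[of S] by (intro add_left_mono ln_le_minus_one) simp
    finally have "?a E S * ln (?a E S / gnp_prob (Suc k) p (add_vertex k E S)) \<le>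
        ?a E S * (ln (?b E / gnp_prob k p E) + (?a E S / (?b E * ?w S) - 1))"
      using a by (intro mult_left_mono) auto
    also have "\<dots> = ?a E S * ln (?b E / gnp_prob k p E) + ((?a E S)\<^sup>2 / ?b E) / ?w S - ?a E S"
      by (simp add: algebra_simps power2_eq_square)
    also have "\<dots> \<le> ?a E S * ln (?b E / gnp_prob k p E) + ?J E S / ?w S - ?a E S"
      using graph_prob_add_vertex_square[OF E b, of S] w[of S]
      by (intro diff_right_mono add_left_mono divide_right_mono) auto
    finally show ?thesis .
  qed
  have "graph_kl (Suc k) \<le> (\<Sum>E\<in>graphs k. \<Sum>S\<in>Pow {..<k}.
      ?a E S * ln (?b E / gnp_prob k p E) + ?J E S / ?w S - ?a E S)"
    unfolding graph_kl_def sum_graphs_Suc by (intro sum_mono step)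
  also have "\<dots> = (\<Sum>E\<in>graphs k. (\<Sum>S\<in>Pow {..<k}. ?a E S) * ln (?b E / gnp_prob k p E)) +
      (\<Sum>E\<in>graphs k. \<Sum>S\<in>Pow {..<k}. ?J E S / ?w S) - (\<Sum>E\<in>graphs k. \<Sum>S\<in>Pow {..<k}. ?a E S)"
    by (simp add: sum.distrib sum_subtractf sum_distrib_right)
  also have "\<dots> = graph_kl k + (\<Sum>E\<in>graphs k. \<Sum>S\<in>Pow {..<k}. ?J E S / ?w S) - 1"
    by (simp add: marginal graph_kl_def sum_graph_prob cong: sum.cong)
  \<comment> \<open>Summing over E first removes the old graph altogether, because for fixed labels
    the weights of all graphs add up to 1.\<close>
  also have "(\<Sum>E\<in>graphs k. \<Sum>S\<in>Pow {..<k}. ?J E S / ?w S) =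
      (\<Sum>S\<in>Pow {..<k}. (\<Sum>E\<in>graphs k. ?J E S) / ?w S)"
    by (subst sum.swap) (simp add: sum_divide_distrib)
  also have "\<dots> = (\<Sum>S\<in>Pow {..<k}. (\<integral>X. (nbr_prob k S X)\<^sup>2 \<partial>?P) / ?w S)"
  proof (intro sum.cong refl arg_cong2[where f = "(/)"])
    fix S
    have "(\<Sum>E\<in>graphs k. ?J E S) = (\<integral>X. (\<Sum>E\<in>graphs k. graph_weight k E X * (nbr_prob k S X)\<^sup>2) \<partial>?P)"
      using i2 by (intro Bochner_Integration.integral_sum[symmetric])
    then show "(\<Sum>E\<in>graphs k. ?J E S) = (\<integral>X. (nbr_prob k S X)\<^sup>2 \<partial>?P)"
      by (simp add: sum_graph_weight flip: sum_distrib_right)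
  qed
  also have "\<dots> = codegree_moment k" by (rule sum_integral_nbr_prob_square[OF p])
  finally show ?thesis by simp
qed

lemma graph_kl_le:
  assumes "0 < p" "p < 1"
  shows "graph_kl n \<le> (\<Sum>k<n. codegree_moment k - 1)"
proof (induction n)
  case 0
  have "all_pairs 0 = {}" by (auto simp: all_pairs_def)
  moreover have "graphs 0 = {{}}" by (auto simp: graphs_def all_pairs_def)
  moreover have "graph_prob 0 {} = 1"
    using sum_graph_prob[of 0] calculation by simp
  ultimately show ?case by (simp add: graph_kl_def gnp_prob_def)
next
  case (Suc n)
  then show ?case using graph_kl_Suc[OF assms, of n] by simp
qed

lemma tv_graph_prob_le:
  assumes "0 < p" "p < 1"
  shows "tv_fin (graphs n) (graph_prob n) (gnp_prob n p) \<le> sqrt (\<Sum>k<n. codegree_moment k - 1)"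
proof -
  have "tv_fin (graphs n) (graph_prob n) (gnp_prob n p) \<le> sqrt (graph_kl n)"
    unfolding graph_kl_def using assms
    by (intro tv_fin_le_sqrt_kl) (auto simp: graph_prob_nonneg gnp_prob_pos sum_graph_prob sum_gnp_prob)
  also have "\<dots> \<le> sqrt (\<Sum>k<n. codegree_moment k - 1)"
    by (intro real_sqrt_le_mono graph_kl_le assms)
  finally show ?thesis .
qed

end

section \<open>Moments of the codegree\<close>

text \<open>Both signs are needed, since a centred codegree takes both. For x = -y < 0 the bound
  follows from exp (-y) \<le> 1 / (1 + y) and (1 - y + y^2)(1 + y) = 1 + y^3.\<close>

lemma exp_le_quadratic:
  fixes x :: real
  assumes "\<bar>x\<bar> \<le> 1"
  shows "exp x \<le> 1 + x + x\<^sup>2"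
proof (cases "x \<ge> 0")
  case True
  then show ?thesis using exp_bound[of x] assms by simp
next
  case False
  define y where "y = - x"
  have y: "y > 0" using False by (simp add: y_def)
  have "exp x = inverse (exp y)" by (simp add: y_def exp_minus)
  also have "\<dots> \<le> inverse (1 + y)" using y exp_ge_add_one_self[of y] by (intro le_imp_inverse_le) auto
  also have "\<dots> \<le> 1 - y + y\<^sup>2"
  proof -
    have "(1 - y + y\<^sup>2) * (1 + y) = 1 + y ^ 3" by (simp add: algebra_simps power2_eq_square power3_eq_cube)
    then have "1 \<le> (1 - y + y\<^sup>2) * (1 + y)" using y by simp
    then show ?thesis using y by (simp add: inverse_eq_divide pos_divide_le_eq)
  qed
  finally show ?thesis by (simp add: y_def)
qed

context latent_kernel
begin

lemma p_bounds: "0 \<le> p" "p \<le> 1"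
proof -
  obtain z where z: "z \<in> space M" using not_empty by blast
  then show "0 \<le> p" "p \<le> 1"
    using integral_unit_interval[of "\<lambda>x. s x z"] s_mean[OF z] by auto
qed

lemma codegree_pair_measurable [measurable]: "case_prod codegree \<in> borel_measurable (M \<Otimes>\<^sub>M M)"
  by measurable

text \<open>The inner integral is p^2 already for each fixed z: z' is integrated out first, at fixed
  x, using symmetry of s, and x afterwards. This is what makes the linear terms vanish.\<close>

lemma integral_codegree: "(\<integral>z. (\<integral>z'. codegree z z' \<partial>M) \<partial>M) = p\<^sup>2"
proof -
  have inner: "(\<integral>z'. codegree z z' \<partial>M) = p\<^sup>2" if z [measurable]: "z \<in> space M" for z
  proof -
    have "(\<integral>z'. codegree z z' \<partial>M) = (\<integral>x. (\<integral>z'. s x z * s x z' \<partial>M) \<partial>M)"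
      unfolding codegree_def
      by (rule iterated_integral_swap[where B = 1])
        (auto simp: prob_space_axioms abs_mult intro!: mult_le_one)
    also have "\<dots> = (\<integral>x. s x z * p \<partial>M)"
    proof (intro Bochner_Integration.integral_cong refl)
      fix x assume "x \<in> space M"
      then show "(\<integral>z'. s x z * s x z' \<partial>M) = s x z * p"
        using s_mean[of x] s_sym[of x] by simp
    qed
    also have "\<dots> = p\<^sup>2" using s_mean[OF z] by (simp add: power2_eq_square)
    finally show ?thesis .
  qed
  have "(\<integral>z. (\<integral>z'. codegree z z' \<partial>M) \<partial>M) = (\<integral>z. p\<^sup>2 \<partial>M)"
    by (intro Bochner_Integration.integral_cong refl inner)
  then show ?thesis by (simp add: prob_space)
qed

lemma codegree_compl_le:
  assumes [measurable]: "z \<in> space M" "z' \<in> space M"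
  shows "1 - 2 * p + codegree z z' \<le> 1 - p"
proof -
  have "(\<integral>x. s x z * s x z' \<partial>M) \<le> (\<integral>x. s x z \<partial>M)"
    using assms by (intro integral_mono) (auto simp: mult_left_le)
  then show ?thesis using assms by (simp add: codegree_def s_mean)
qed

text \<open>
  The probability W that both z and z' miss a random point satisfies W \<le> u and E W = u^2, so
  W^2 \<le> u W already gives E W^2 \<le> u^3 without knowing the shape of the overlap.
\<close>

lemma codegree_power_moment_le:
  assumes u: "u = 1 - p" "u \<le> 1 / 2" and j: "4 * real j * u \<le> 1"
  shows "(\<integral>z. (\<integral>z'. (codegree z z' / p\<^sup>2) ^ j \<partial>M) \<partial>M) \<le> 1 + 16 * (real j)\<^sup>2 * u ^ 3"
proof -
  interpret MM: pair_prob_space M M ..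
  have p: "p \<ge> 1 / 2" "p > 0" using u by auto
  have u0: "u \<ge> 0" using u p_bounds by simp
  have p2: "1 / p\<^sup>2 \<le> 4"
  proof -
    have "(1 / 2)\<^sup>2 \<le> p\<^sup>2" using p by (intro power_mono) auto
    then show ?thesis using p by (simp add: field_simps power2_eq_square)
  qed
  \<comment> \<open>The power is majorised by an affine function of the codegree, whose mean is
    known, so only \<beta> survives integration. \<beta> is the value at W = u^2 of 1 + j \<xi> + 16
    j^2 (u W - 2 u^2 W + u^4) and \<alpha> its slope in W; here 16 bounds 1 / p^4.\<close>
  define \<alpha> where "\<alpha> = real j / p\<^sup>2 + 16 * (real j)\<^sup>2 * (u - 2 * u\<^sup>2)"
  define \<beta> where "\<beta> = 1 + 16 * (real j)\<^sup>2 * (u ^ 3 - u ^ 4)"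
  have pointwise: "(codegree z z' / p\<^sup>2) ^ j \<le> \<beta> + \<alpha> * (codegree z z' - p\<^sup>2)"
    if z: "z \<in> space M" "z' \<in> space M" for z z'
  proof -
    define W where "W = 1 - 2 * p + codegree z z'"
    define \<xi> where "\<xi> = (W - u\<^sup>2) / p\<^sup>2"
    have W: "0 \<le> W" "W \<le> u"
      using codegree_compl_bounds(1)[OF z] codegree_compl_le[OF z] u by (auto simp: W_def)
    have c: "codegree z z' - p\<^sup>2 = W - u\<^sup>2"
      by (simp add: W_def u power2_eq_square algebra_simps)
    have cx: "codegree z z' / p\<^sup>2 = 1 + \<xi>"
      using c p by (simp add: \<xi>_def field_simps)
    have uu: "u\<^sup>2 \<le> u" using u u0 by (simp add: power2_eq_square mult_left_le)
    \<comment> \<open>This leads to |\<xi>| \<le> 4 u, so that 4 j u \<le> 1 puts j \<xi> within the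
      range of \<open>exp_le_quadratic\<close>.\<close>
    have "\<bar>W - u\<^sup>2\<bar> \<le> u" using W uu zero_le_power2[of u] by linarith
    then have "\<bar>\<xi>\<bar> \<le> u * (1 / p\<^sup>2)" by (simp add: \<xi>_def divide_right_mono)
    also have "\<dots> \<le> u * 4" using p2 u0 by (intro mult_left_mono)
    finally have "real j * \<bar>\<xi>\<bar> \<le> real j * (u * 4)" by (intro mult_left_mono) auto
    then have jx: "\<bar>real j * \<xi>\<bar> \<le> 1" using j by (simp add: abs_mult)
    have "0 \<le> 1 + \<xi>" unfolding cx[symmetric] using codegree_bounds(1)[OF z] by simp
    then have "(1 + \<xi>) ^ j \<le> exp \<xi> ^ j" by (intro power_mono) auto
    also have "\<dots> = exp (real j * \<xi>)" by (simp add: exp_of_nat_mult)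
    also have "\<dots> \<le> 1 + real j * \<xi> + (real j * \<xi>)\<^sup>2" by (rule exp_le_quadratic[OF jx])
    also have "(real j * \<xi>)\<^sup>2 \<le> (real j)\<^sup>2 * (16 * (u * W - 2 * u\<^sup>2 * W + u ^ 4))"
    proof -
      have "(1 / p\<^sup>2)\<^sup>2 \<le> 4\<^sup>2" using p2 by (intro power_mono) auto
      then have "\<xi>\<^sup>2 \<le> (W - u\<^sup>2)\<^sup>2 * 16"
        unfolding \<xi>_def power_divide by (simp add: power_divide divide_inverse mult_left_mono)
      moreover have "(W - u\<^sup>2)\<^sup>2 \<le> u * W - 2 * u\<^sup>2 * W + u ^ 4"
      proof -
        have "W * W \<le> u * W" using W by (intro mult_right_mono)
        then show ?thesis by (simp add: power2_eq_square algebra_simps power4_eq_xxxx)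
      qed
      ultimately have "\<xi>\<^sup>2 \<le> 16 * (u * W - 2 * u\<^sup>2 * W + u ^ 4)" by simp
      then show ?thesis unfolding power_mult_distrib by (intro mult_left_mono) auto
    qed
    also have "1 + real j * \<xi> + (real j)\<^sup>2 * (16 * (u * W - 2 * u\<^sup>2 * W + u ^ 4)) = \<beta> + \<alpha> * (W - u\<^sup>2)"
      by (simp add: \<beta>_def \<alpha>_def \<xi>_def algebra_simps power2_eq_square power3_eq_cube power4_eq_xxxx)
    finally show ?thesis unfolding cx c by simp
  qed
  have b: "\<bar>codegree z z'\<bar> \<le> 1" if "z \<in> space M" "z' \<in> space M" for z z'
    using codegree_bounds[OF that] by simp
  have ic: "integrable (M \<Otimes>\<^sub>M M) (case_prod codegree)"
    by (rule integrable_pair_bounded[OF prob_space_axioms prob_space_axioms _ b]) measurable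
  have Ec: "(\<integral>zz. case_prod codegree zz \<partial>(M \<Otimes>\<^sub>M M)) = p\<^sup>2"
    using iterated_integral_eq_pair[OF prob_space_axioms prob_space_axioms codegree_pair_measurable b]
    by (simp add: integral_codegree)
  have pb: "\<bar>(codegree z z' / p\<^sup>2) ^ j\<bar> \<le> (1 / p\<^sup>2) ^ j" if "z \<in> space M" "z' \<in> space M" for z z'
    using b[OF that] by (simp add: power_abs abs_divide power_mono divide_right_mono)
  have pm: "case_prod (\<lambda>z z'. (codegree z z' / p\<^sup>2) ^ j) \<in> borel_measurable (M \<Otimes>\<^sub>M M)" by measurable
  have "(\<integral>z. (\<integral>z'. (codegree z z' / p\<^sup>2) ^ j \<partial>M) \<partial>M) =
      (\<integral>zz. case_prod (\<lambda>z z'. (codegree z z' / p\<^sup>2) ^ j) zz \<partial>(M \<Otimes>\<^sub>M M))"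
    by (rule iterated_integral_eq_pair[OF prob_space_axioms prob_space_axioms pm pb])
  also have "\<dots> \<le> (\<integral>zz. \<beta> + \<alpha> * (case_prod codegree zz - p\<^sup>2) \<partial>(M \<Otimes>\<^sub>M M))"
  proof (rule integral_mono)
    show "integrable (M \<Otimes>\<^sub>M M) (case_prod (\<lambda>z z'. (codegree z z' / p\<^sup>2) ^ j))"
      by (rule integrable_pair_bounded[OF prob_space_axioms prob_space_axioms pm pb])
    show "integrable (M \<Otimes>\<^sub>M M) (\<lambda>zz. \<beta> + \<alpha> * (case_prod codegree zz - p\<^sup>2))"
      using ic by simp
  qed (auto simp: space_pair_measure pointwise)
  also have "\<dots> = \<beta>" using ic Ec by (simp add: MM.prob_space)
  also have "\<beta> \<le> 1 + 16 * (real j)\<^sup>2 * u ^ 3"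
    unfolding \<beta>_def using u0 by (intro add_left_mono mult_left_mono) auto
  finally show ?thesis .
qed

text \<open>\<open>Bernstein k j q\<close> is the binomial probability of j successes in k trials.
  The identity is purely algebraic; reading the weights as probabilities additionally requires q
  \<le> 1.\<close>

lemma codegree_moment_eq_Bernstein:
  assumes p: "0 < p" "p < 1"
  shows "codegree_moment k = (\<Sum>j\<le>k. Bernstein k j (p / (1 - p)) *
    (\<integral>z. (\<integral>z'. (codegree z z' / p\<^sup>2) ^ j \<partial>M) \<partial>M))"
proof -
  let ?q = "p / (1 - p)"
  let ?y = "\<lambda>z z'. codegree z z' / p\<^sup>2"
  have b: "\<bar>codegree z z'\<bar> \<le> 1" if "z \<in> space M" "z' \<in> space M" for z z'
    using codegree_bounds[OF that] by simp
  have pb: "\<bar>?y z z' ^ j\<bar> \<le> (1 / p\<^sup>2) ^ j" if "z \<in> space M" "z' \<in> space M" for z z' j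
    using b[OF that] by (simp add: power_abs abs_divide power_mono divide_right_mono)
  have pm: "case_prod (\<lambda>z z'. ?y z z' ^ j) \<in> borel_measurable (M \<Otimes>\<^sub>M M)" for j by measurable
  have int: "integrable (M \<Otimes>\<^sub>M M) (case_prod (\<lambda>z z'. ?y z z' ^ j))" for j
    by (rule integrable_pair_bounded[OF prob_space_axioms prob_space_axioms pm pb])
  have expand: "(codegree z z' / p + (1 - 2 * p + codegree z z') / (1 - p)) ^ k =
      (\<Sum>j\<le>k. Bernstein k j ?q * ?y z z' ^ j)" for z z'
  proof -
    have *: "codegree z z' / p + (1 - 2 * p + codegree z z') / (1 - p) = ?q * ?y z z' + (1 - ?q)"
    proof -
      have "?q * ?y z z' = codegree z z' / p + codegree z z' / (1 - p)"
        using p by (simp add: divide_simps power2_eq_square) (simp add: algebra_simps)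
      moreover have "1 - ?q = (1 - 2 * p) / (1 - p)" using p by (simp add: field_simps)
      ultimately show ?thesis by (simp add: add_divide_distrib)
    qed
    show ?thesis
      unfolding * binomial_ring Bernstein_def power_mult_distrib by (simp add: mult_ac)
  qed
  have "codegree_moment k = (\<integral>zz. case_prod (\<lambda>z z'. \<Sum>j\<le>k. Bernstein k j ?q * ?y z z' ^ j) zz \<partial>(M \<Otimes>\<^sub>M M))"
    unfolding codegree_moment_def expand
  proof (rule iterated_integral_eq_pair)
    fix z z' assume z: "z \<in> space M" "z' \<in> space M"
    have "\<bar>\<Sum>j\<le>k. Bernstein k j ?q * ?y z z' ^ j\<bar> \<le> (\<Sum>j\<le>k. \<bar>Bernstein k j ?q\<bar> * \<bar>?y z z' ^ j\<bar>)"
      unfolding abs_mult[symmetric] by (rule sum_abs)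
    also have "\<dots> \<le> (\<Sum>j\<le>k. \<bar>Bernstein k j ?q\<bar> * (1 / p\<^sup>2) ^ j)"
      by (intro sum_mono mult_left_mono pb z) auto
    finally show "\<bar>\<Sum>j\<le>k. Bernstein k j ?q * ?y z z' ^ j\<bar> \<le> (\<Sum>j\<le>k. \<bar>Bernstein k j ?q\<bar> * (1 / p\<^sup>2) ^ j)" .
  qed (use prob_space_axioms in measurable)
  also have "\<dots> = (\<integral>zz. (\<Sum>j\<le>k. Bernstein k j ?q * case_prod (\<lambda>z z'. ?y z z' ^ j) zz) \<partial>(M \<Otimes>\<^sub>M M))"
    by (intro Bochner_Integration.integral_cong) auto
  also have "\<dots> = (\<Sum>j\<le>k. Bernstein k j ?q * (\<integral>zz. case_prod (\<lambda>z z'. ?y z z' ^ j) zz \<partial>(M \<Otimes>\<^sub>M M)))"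
    using int by (subst Bochner_Integration.integral_sum) auto
  also have "\<dots> = (\<Sum>j\<le>k. Bernstein k j ?q * (\<integral>z. (\<integral>z'. ?y z z' ^ j \<partial>M) \<partial>M))"
    by (simp only: iterated_integral_eq_pair[OF prob_space_axioms prob_space_axioms pm pb])
  finally show ?thesis .
qed

section \<open>Products of a kernel over independent coordinates\<close>

lemma latent_kernel_power:
  "latent_kernel (PiM {..<d} (\<lambda>_. M)) (\<lambda>x y. \<Prod>i<d. s (x i) (y i)) (p ^ d)"
proof -
  interpret P: prob_space "PiM {..<d} (\<lambda>_. M)" by (rule prob_space_points)
  show ?thesis
  proof unfold_locales
    fix z assume "z \<in> space (PiM {..<d} (\<lambda>_. M))"
    then have z: "z i \<in> space M" if "i < d" for i using that by (auto simp: space_PiM)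
    have "(\<integral>x. (\<Prod>i<d. s (x i) (z i)) \<partial>PiM {..<d} (\<lambda>_. M)) = (\<Prod>i<d. \<integral>x. s x (z i) \<partial>M)"
      using z by (intro vertices.product_integral_prod) auto
    then show "(\<integral>x. (\<Prod>i<d. s (x i) (z i)) \<partial>PiM {..<d} (\<lambda>_. M)) = p ^ d"
      using z by (simp add: s_mean)
  qed (auto intro: prod_nonneg prod_le_1 simp: s_sym)
qed

lemma codegree_latent_kernel_power:
  fixes d :: nat
  assumes "z \<in> space (PiM {..<d} (\<lambda>_. M))" "z' \<in> space (PiM {..<d} (\<lambda>_. M))"
  shows "latent_kernel.codegree (PiM {..<d} (\<lambda>_. M)) (\<lambda>x y. \<Prod>i<d. s (x i) (y i)) z z' =
    (\<Prod>i<d. codegree (z i) (z' i))"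
proof -
  have z: "z i \<in> space M" "z' i \<in> space M" if "i < d" for i using that assms by (auto simp: space_PiM)
  have "latent_kernel.codegree (PiM {..<d} (\<lambda>_. M)) (\<lambda>x y. \<Prod>i<d. s (x i) (y i)) z z' =
      (\<integral>x. (\<Prod>i<d. s (x i) (z i) * s (x i) (z' i)) \<partial>PiM {..<d} (\<lambda>_. M))"
    unfolding latent_kernel.codegree_def[OF latent_kernel_power] prod.distrib ..
  also have "\<dots> = (\<Prod>i<d. \<integral>x. s x (z i) * s x (z' i) \<partial>M)"
    using z by (intro vertices.product_integral_prod) auto
  finally show ?thesis by (simp add: codegree_def)
qed

lemma codegree_power_moment_latent_kernel_power:
  fixes d :: nat
  shows
  "(\<integral>z. (\<integral>z'. (latent_kernel.codegree (PiM {..<d} (\<lambda>_. M)) (\<lambda>x y. \<Prod>i<d. s (x i) (y i)) z z' / (p ^ d)\<^sup>2) ^ j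
      \<partial>PiM {..<d} (\<lambda>_. M)) \<partial>PiM {..<d} (\<lambda>_. M)) =
    (\<integral>z. (\<integral>z'. (codegree z z' / p\<^sup>2) ^ j \<partial>M) \<partial>M) ^ d"
proof -
  let ?P = "PiM {..<d} (\<lambda>_. M)"
  let ?y = "\<lambda>a b. (codegree a b / p\<^sup>2) ^ j"
  have pb: "\<bar>?y a b\<bar> \<le> (1 / p\<^sup>2) ^ j" if "a \<in> space M" "b \<in> space M" for a b
    using codegree_bounds[OF that] by (simp add: power_abs abs_divide power_mono divide_right_mono)
  have int: "integrable M (?y a)" if [measurable]: "a \<in> space M" for a
    using pb[OF that] by (intro integrable_bounded) (measurable, auto)
  have int2: "integrable M (\<lambda>a. \<integral>b. ?y a b \<partial>M)"
  proof (rule integrable_bounded)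
    fix a assume a: "a \<in> space M"
    have "\<bar>\<integral>b. ?y a b \<partial>M\<bar> \<le> (\<integral>b. \<bar>?y a b\<bar> \<partial>M)" by (rule integral_abs_bound)
    also have "\<dots> \<le> (1 / p\<^sup>2) ^ j"
      using int[OF a] pb[OF a] by (intro integral_le_const integrable_abs) (auto intro: AE_I2)
    finally show "\<bar>\<integral>b. ?y a b \<partial>M\<bar> \<le> (1 / p\<^sup>2) ^ j" .
  qed measurable
  have "(\<integral>z. (\<integral>z'. (latent_kernel.codegree ?P (\<lambda>x y. \<Prod>i<d. s (x i) (y i)) z z' / (p ^ d)\<^sup>2) ^ j \<partial>?P) \<partial>?P) =
      (\<integral>z. (\<integral>z'. (\<Prod>i<d. ?y (z i) (z' i)) \<partial>?P) \<partial>?P)"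
    by (intro Bochner_Integration.integral_cong refl)
      (simp add: codegree_latent_kernel_power prod_dividef prod_power_distrib power_divide
        flip: power_mult, simp add: mult_ac)
  also have "\<dots> = (\<integral>z. (\<Prod>i<d. \<integral>b. ?y (z i) b \<partial>M) \<partial>?P)"
  proof (intro Bochner_Integration.integral_cong refl)
    fix z assume "z \<in> space ?P"
    then show "(\<integral>z'. (\<Prod>i<d. ?y (z i) (z' i)) \<partial>?P) = (\<Prod>i<d. \<integral>b. ?y (z i) b \<partial>M)"
      by (intro vertices.product_integral_prod int) (auto simp: space_PiM)
  qed
  also have "\<dots> = (\<Prod>i<d. \<integral>a. (\<integral>b. ?y a b \<partial>M) \<partial>M)"
    using int2 by (intro vertices.product_integral_prod) auto
  finally show ?thesis by simp
qed

text \<open>Here p is the density on a single coordinate, and \<open>p ^ d\<close> is the edge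
  density of the graph. The first condition on n controls the moments on one coordinate, the second
  their d-th powers.\<close>

lemma tv_latent_kernel_power_le:
  fixes d n :: nat
  assumes p: "0 < p" "p ^ d \<le> 1 / 2" and u: "u = 1 - p" "u \<le> 1 / 2"
    and n: "4 * real n * u \<le> 1" "16 * (real n)\<^sup>2 * u ^ 3 * real d \<le> 1"
  defines "q \<equiv> p ^ d / (1 - p ^ d)"
  shows "tv_fin (graphs n)
      (latent_kernel.graph_prob (PiM {..<d} (\<lambda>_. M)) (\<lambda>x y. \<Prod>i<d. s (x i) (y i)) n) (gnp_prob n (p ^ d))
    \<le> sqrt (real n * (32 * (real n * q + (real n)\<^sup>2 * q\<^sup>2) * u ^ 3 * real d))"
proof -
  interpret T: latent_kernel "PiM {..<d} (\<lambda>_. M)" "\<lambda>x y. \<Prod>i<d. s (x i) (y i)" "p ^ d"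
    by (rule latent_kernel_power)
  have pd: "0 < p ^ d" "p ^ d < 1" using p by auto
  have q: "0 \<le> q" "q \<le> 1" using pd p(2) by (auto simp: q_def divide_le_eq)
  have u0: "u \<ge> 0" using u p_bounds by simp
  define I where "I = (\<lambda>j :: nat. \<integral>z. (\<integral>z'. (codegree z z' / p\<^sup>2) ^ j \<partial>M) \<partial>M)"
  have I0: "0 \<le> I j" for j
    unfolding I_def using codegree_bounds by (intro Bochner_Integration.integral_nonneg) auto
  have I: "I j ^ d \<le> 1 + 32 * (real j)\<^sup>2 * u ^ 3 * real d" if "j < n" for j
  proof -
    define x where "x = 16 * (real j)\<^sup>2 * u ^ 3"
    have "4 * real j * u \<le> 4 * real n * u" using that u0 by (intro mult_right_mono) auto
    then have "I j \<le> 1 + x"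
      unfolding I_def x_def using n(1) by (intro codegree_power_moment_le u) auto
    also have "\<dots> \<le> exp x" by (rule exp_ge_add_one_self)
    finally have "I j ^ d \<le> exp x ^ d" using I0 by (intro power_mono) auto
    also have "\<dots> = exp (real d * x)" by (simp add: exp_of_nat_mult)
    finally have le: "I j ^ d \<le> exp (real d * x)" .
    have x0: "0 \<le> real d * x" using u0 by (simp add: x_def)
    have "(real j)\<^sup>2 \<le> (real n)\<^sup>2" using that by (intro power_mono) auto
    then have "x \<le> 16 * (real n)\<^sup>2 * u ^ 3" unfolding x_def using u0 by (intro mult_right_mono) auto
    then have "real d * x \<le> real d * (16 * (real n)\<^sup>2 * u ^ 3)" by (intro mult_left_mono) auto
    then have x1: "real d * x \<le> 1" using n(2) by (simp add: mult.commute)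
    \<comment> \<open>For y in [0, 1] this yields exp y \<le> 1 + 2 y, which doubles the constant 16
      to 32.\<close>
    have "exp (real d * x) \<le> 1 + real d * x + (real d * x)\<^sup>2"
      using x0 x1 by (intro exp_le_quadratic) auto
    also have "(real d * x)\<^sup>2 \<le> real d * x"
      unfolding power2_eq_square using x0 x1 by (rule mult_left_le[rotated])
    finally show ?thesis using le by (simp add: x_def algebra_simps)
  qed
  have moment: "T.codegree_moment k - 1 \<le> 32 * (real n * q + (real n)\<^sup>2 * q\<^sup>2) * u ^ 3 * real d" if "k < n" for k
  proof -
    have "T.codegree_moment k = (\<Sum>j\<le>k. Bernstein k j q * I j ^ d)"
      unfolding T.codegree_moment_eq_Bernstein[OF pd] codegree_power_moment_latent_kernel_power
      by (simp add: I_def q_def)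
    also have "\<dots> \<le> (\<Sum>j\<le>k. Bernstein k j q * (1 + 32 * (real j)\<^sup>2 * u ^ 3 * real d))"
      using that q by (intro sum_mono mult_left_mono I Bernstein_nonneg) auto
    \<comment> \<open>Writing j^2 = j (j - 1) + j exposes the factorial moments of the binomial law,
      k (k - 1) q^2 and k q.\<close>
    also have "\<dots> = (\<Sum>j\<le>k. Bernstein k j q + 32 * u ^ 3 * real d *
        (real j * (real j - 1) * Bernstein k j q + real j * Bernstein k j q))"
      by (intro sum.cong) (auto simp: algebra_simps power2_eq_square)
    also have "\<dots> = 1 + 32 * u ^ 3 * real d * (real k * (real k - 1) * q\<^sup>2 + real k * q)"
      by (simp add: sum.distrib flip: sum_distrib_left)
    also have "\<dots> \<le> 1 + 32 * u ^ 3 * real d * ((real n)\<^sup>2 * q\<^sup>2 + real n * q)"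
    proof -
      have "real k * (real k - 1) \<le> real n * real n"
        by (rule order_trans[of _ "real k * real k"])
          (use that in \<open>auto intro!: mult_mono mult_left_mono\<close>)
      then have "real k * (real k - 1) * q\<^sup>2 + real k * q \<le> (real n)\<^sup>2 * q\<^sup>2 + real n * q"
        using that q by (intro add_mono mult_right_mono) (auto simp: power2_eq_square)
      then show ?thesis using u0 by (intro add_left_mono mult_left_mono) auto
    qed
    finally show ?thesis by (simp add: algebra_simps)
  qed
  have "tv_fin (graphs n) (T.graph_prob n) (gnp_prob n (p ^ d)) \<le> sqrt (\<Sum>k<n. T.codegree_moment k - 1)"
    by (rule T.tv_graph_prob_le[OF pd])
  also have "\<dots> \<le> sqrt (\<Sum>k<n. 32 * (real n * q + (real n)\<^sup>2 * q\<^sup>2) * u ^ 3 * real d)"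
    by (intro real_sqrt_le_mono sum_mono moment) auto
  finally show ?thesis by simp
qed

end

section \<open>The circle and the torus\<close>

definition circ_kernel :: "real \<Rightarrow> real \<Rightarrow> real \<Rightarrow> real" where
  "circ_kernel t x y = of_bool (circ_dist x y \<le> t)"

abbreviation circle_unif :: "real measure" where
  "circle_unif \<equiv> uniform_measure lborel {0..<2}"

lemma prob_space_circle_unif: "prob_space circle_unif"
  by (rule prob_space_uniform_measure) auto

lemma circ_dist_measurable: "case_prod circ_dist \<in> borel_measurable (borel \<Otimes>\<^sub>M borel)"
  unfolding circ_dist_def frac_def Let_def split_def by measurable

lemma circ_dist_sym: "circ_dist x y = circ_dist y x"
proof -
  have *: "(y - x) / 2 = - ((x - y) / 2)" by (simp add: field_simps)
  show ?thesis
    unfolding circ_dist_def Let_def * frac_neg by (auto simp: min_def frac_eq_0_iff[THEN iffD2])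
qed

text \<open>The measure lives on all reals, so a second argument may lie outside [0, 2) and is
  written as a + 2 m. Then x - a lies in (-2, 2), and \<open>frac\<close> either leaves (x - a) / 2
  alone or adds 1.\<close>

lemma circ_dist_cases:
  fixes x a m :: real
  assumes x: "0 \<le> x" "x < 2" and a: "0 \<le> a" "a < 2" and m: "m \<in> \<int>"
  shows "circ_dist x (a + 2 * m) = min \<bar>x - a\<bar> (2 - \<bar>x - a\<bar>)"
proof -
  have e: "(x - (a + 2 * m)) / 2 = (x - a) / 2 - m" by (simp add: field_simps)
  show ?thesis
  proof (cases "a \<le> x")
    case True
    have fr: "frac ((x - a) / 2 - m) = (x - a) / 2"
      unfolding frac_unique_iff using True x a m by auto
    show ?thesis using True unfolding circ_dist_def Let_def e fr by (simp add: min_def field_simps)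
  next
    case False
    have fr: "frac ((x - a) / 2 - m) = (x - a) / 2 + 1"
    proof -
      have "0 \<le> (x - a) / 2 + 1" using x a by (simp add: field_simps)
      then show ?thesis unfolding frac_unique_iff using False m by auto
    qed
    have fr2: "2 * ((x - a) / 2 + 1) = 2 - (a - x)" by (simp add: field_simps)
    show ?thesis using False unfolding circ_dist_def Let_def e fr fr2 by (simp add: min.commute)
  qed
qed

text \<open>The sandwich between open and closed intervals avoids deciding which endpoints belong to
  B. Two intervals are needed because an arc may wrap around 0.\<close>

lemma emeasure_lborel_two_intervals:
  fixes l1 r1 l2 r2 :: real
  assumes le: "l1 \<le> r1" "r1 \<le> l2" "l2 \<le> r2" and B: "B \<in> sets lborel"
    and sub: "{l1<..<r1} \<union> {l2<..<r2} \<subseteq> B" "B \<subseteq> {l1..r1} \<union> {l2..r2}"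
  shows "emeasure lborel B = ennreal (r1 - l1 + (r2 - l2))"
proof (rule antisym)
  have "emeasure lborel B \<le> emeasure lborel ({l1..r1} \<union> {l2..r2})"
    using sub(2) by (intro emeasure_mono) auto
  also have "\<dots> \<le> emeasure lborel {l1..r1} + emeasure lborel {l2..r2}"
    by (rule emeasure_subadditive) auto
  also have "\<dots> = ennreal (r1 - l1 + (r2 - l2))"
    using le by (simp flip: ennreal_plus)
  finally show "emeasure lborel B \<le> ennreal (r1 - l1 + (r2 - l2))" .
  have "ennreal (r1 - l1 + (r2 - l2)) = emeasure lborel {l1<..<r1} + emeasure lborel {l2<..<r2}"
    using le by (simp flip: ennreal_plus)
  also have "\<dots> = emeasure lborel ({l1<..<r1} \<union> {l2<..<r2})"
    using le by (intro plus_emeasure) auto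
  also have "\<dots> \<le> emeasure lborel B"
    using sub(1) B by (intro emeasure_mono) auto
  finally show "ennreal (r1 - l1 + (r2 - l2)) \<le> emeasure lborel B" .
qed

text \<open>A ball of radius t is an arc of length 2 t on a circle of length 2. That its measure is
  the same for every centre b is the constant density required of a
  \<open>latent_kernel\<close>.\<close>

lemma measure_circ_dist_le:
  assumes t: "0 \<le> t" "t \<le> 1"
  shows "measure circle_unif {x. circ_dist x b \<le> t} = t"
proof -
  define m where "m = real_of_int \<lfloor>b / 2\<rfloor>"
  define a where "a = b - 2 * m"
  have a: "0 \<le> a" "a < 2" unfolding a_def m_def by linarith+
  have m: "m \<in> \<int>" by (simp add: m_def)
  let ?A = "{x. circ_dist x b \<le> t}"
  let ?B = "{0..<2} \<inter> ?A"
  have B: "x \<in> ?B \<longleftrightarrow> 0 \<le> x \<and> x < 2 \<and> (\<bar>x - a\<bar> \<le> t \<or> 2 - \<bar>x - a\<bar> \<le> t)" for x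
    using circ_dist_cases[of x a m] a m by (auto simp: a_def)
  have A: "?A \<in> sets lborel"
  proof -
    have [measurable]: "(\<lambda>x. circ_dist x b) \<in> borel_measurable borel"
      using measurable_compose[OF _ circ_dist_measurable, of "\<lambda>x. (x, b)" borel] by simp
    show ?thesis by measurable
  qed
  then have Bm: "?B \<in> sets lborel" by auto
  have "emeasure lborel ?B = ennreal (2 * t)"
  proof -
    have sub: "lo \<subseteq> ?B" "?B \<subseteq> up"
      if "\<And>x. x \<in> lo \<Longrightarrow> 0 \<le> x \<and> x < 2 \<and> (\<bar>x - a\<bar> \<le> t \<or> 2 - \<bar>x - a\<bar> \<le> t)"
        "\<And>x. 0 \<le> x \<Longrightarrow> x < 2 \<Longrightarrow> \<bar>x - a\<bar> \<le> t \<or> 2 - \<bar>x - a\<bar> \<le> t \<Longrightarrow> x \<in> up" for lo up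
      unfolding subset_eq Ball_def B using that by blast+
    \<comment> \<open>The arc around a crosses 0, stays inside [0, 2), or crosses 2.\<close>
    consider "a < t" | "t \<le> a" "a \<le> 2 - t" | "2 - t < a" by linarith
    then show ?thesis
    proof cases
      case 1
      have "emeasure lborel ?B = ennreal (a + t - 0 + (2 - (a + 2 - t)))"
        by (intro emeasure_lborel_two_intervals sub Bm)
          (use 1 t a in \<open>auto simp: abs_if split: if_splits\<close>)
      then show ?thesis by simp
    next
      case 2
      \<comment> \<open>The degenerate first interval absorbs the point 0, which lies in the ball
        when a = 2 - t.\<close>
      have "emeasure lborel ?B = ennreal (0 - 0 + (a + t - (a - t)))"
        by (intro emeasure_lborel_two_intervals sub Bm)
          (use 2 t a in \<open>auto simp: abs_if split: if_splits\<close>)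
      then show ?thesis by simp
    next
      case 3
      have "emeasure lborel ?B = ennreal (a - 2 + t - 0 + (2 - (a - t)))"
        by (intro emeasure_lborel_two_intervals sub Bm)
          (use 3 t a in \<open>auto simp: abs_if split: if_splits\<close>)
      then show ?thesis by simp
    qed
  qed
  with A show ?thesis
    using t divide_ennreal[of "2 * t" 2] by (simp add: measure_def)
qed

lemma latent_kernel_circ:
  assumes t: "0 \<le> t" "t \<le> 1"
  shows "latent_kernel circle_unif (circ_kernel t) t"
proof -
  interpret prob_space circle_unif by (rule prob_space_circle_unif)
  have [measurable]: "case_prod circ_dist \<in> borel_measurable (circle_unif \<Otimes>\<^sub>M circle_unif)"
    using circ_dist_measurable by (simp cong: measurable_cong_sets sets_pair_measure_cong)
  show ?thesis
  proof unfold_locales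
    show "case_prod (circ_kernel t) \<in> borel_measurable (circle_unif \<Otimes>\<^sub>M circle_unif)"
    proof -
      have "case_prod (circ_kernel t) = (\<lambda>z. of_bool (case_prod circ_dist z \<le> t))"
        by (auto simp: circ_kernel_def)
      then show ?thesis by simp
    qed
    fix z :: real
    have "(\<integral>x. circ_kernel t x z \<partial>circle_unif) = (\<integral>x. indicator {x. circ_dist x z \<le> t} x \<partial>circle_unif)"
      by (intro Bochner_Integration.integral_cong) (auto simp: circ_kernel_def)
    also have "\<dots> = t" by (simp add: measure_circ_dist_le[OF t])
    finally show "(\<integral>x. circ_kernel t x z \<partial>circle_unif) = t" .
  qed (auto simp: circ_kernel_def circ_dist_sym)
qed

section \<open>The max-distance and its threshold\<close>

lemma linf_dist_le_iff: "0 \<le> t \<Longrightarrow> linf_dist d x y \<le> t \<longleftrightarrow> (\<forall>i<d. circ_dist (x i) (y i) \<le> t)"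
  unfolding linf_dist_def by (subst Max_le_iff) auto

text \<open>A maximum is at most t iff every coordinate is, so a product of 0-1 kernels encodes the
  max-distance rule.\<close>

lemma prod_circ_kernel:
  "0 \<le> t \<Longrightarrow> (\<Prod>i<d. circ_kernel t (x i) (y i)) = of_bool (linf_dist d x y \<le> t)"
  by (auto simp: circ_kernel_def linf_dist_le_iff intro!: prod.neutral)

lemma measure_linf_dist_le:
  assumes t: "0 \<le> t" "t \<le> 1"
  shows "measure (torus_unif d \<Otimes>\<^sub>M torus_unif d)
    {xy \<in> space (torus_unif d \<Otimes>\<^sub>M torus_unif d). linf_dist d (fst xy) (snd xy) \<le> t} = t ^ d"
proof -
  interpret T: latent_kernel "torus_unif d" "\<lambda>x y. \<Prod>i<d. circ_kernel t (x i) (y i)" "t ^ d"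
    unfolding torus_unif_def by (rule latent_kernel.latent_kernel_power[OF latent_kernel_circ[OF t]])
  let ?S = "\<lambda>x y. \<Prod>i<d. circ_kernel t (x i) (y i)"
  let ?TT = "torus_unif d \<Otimes>\<^sub>M torus_unif d"
  have "measure ?TT {xy \<in> space ?TT. linf_dist d (fst xy) (snd xy) \<le> t} =
      (\<integral>xy. indicator {xy \<in> space ?TT. linf_dist d (fst xy) (snd xy) \<le> t} xy \<partial>?TT)"
    by (simp add: Int_absorb2 subset_eq)
  also have "\<dots> = (\<integral>xy. case_prod ?S xy \<partial>?TT)"
    by (intro Bochner_Integration.integral_cong refl) (auto simp: prod_circ_kernel[OF t(1)] split: prod.splits)
  also have "\<dots> = (\<integral>y. (\<integral>x. ?S x y \<partial>torus_unif d) \<partial>torus_unif d)"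
    using iterated_integral_eq_pair[OF T.prob_space_axioms T.prob_space_axioms T.s_pair_measurable, of 1]
      iterated_integral_swap[OF T.prob_space_axioms T.prob_space_axioms T.s_pair_measurable, of 1]
    by simp
  also have "\<dots> = (\<integral>y. t ^ d \<partial>torus_unif d)"
    by (intro Bochner_Integration.integral_cong refl T.s_mean)
  finally show ?thesis by (simp add: T.prob_space)
qed

lemma tau_inf_eq:
  assumes d: "d > 0" and p: "0 \<le> p" "p \<le> 1"
  shows "tau_inf d p = root d p"
  unfolding tau_inf_def
proof (rule the_equality)
  have r: "0 \<le> root d p" "root d p \<le> 1" using d p by (auto simp: real_root_le_1_iff)
  then show "0 \<le> root d p \<and> root d p \<le> 1 \<and> measure (torus_unif d \<Otimes>\<^sub>M torus_unif d)
      {xy \<in> space (torus_unif d \<Otimes>\<^sub>M torus_unif d). linf_dist d (fst xy) (snd xy) \<le> root d p} = p"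
    using d p by (simp add: measure_linf_dist_le)
  fix t assume "0 \<le> t \<and> t \<le> 1 \<and> measure (torus_unif d \<Otimes>\<^sub>M torus_unif d)
      {xy \<in> space (torus_unif d \<Otimes>\<^sub>M torus_unif d). linf_dist d (fst xy) (snd xy) \<le> t} = p"
  then have "0 \<le> t" "t ^ d = p" by (auto simp: measure_linf_dist_le)
  then show "t = root d p" using d by (simp add: real_root_power_cancel flip: \<open>t ^ d = p\<close>)
qed

text \<open>The kernel takes only the values 0 and 1, so no randomness is left once the labels are
  given: \<open>graph_weight\<close> is the indicator that the labels generate E.\<close>

lemma rgg_prob_eq_graph_prob:
  assumes d: "d > 0" and p: "0 \<le> p" "p \<le> 1" and E: "E \<in> graphs n"
  shows "rgg_prob n d p E = latent_kernel.graph_prob (torus_unif d)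
    (\<lambda>x y. \<Prod>i<d. circ_kernel (root d p) (x i) (y i)) n E"
proof -
  define t where "t = root d p"
  have t: "0 \<le> t" "t \<le> 1" using d p by (auto simp: t_def)
  interpret T: latent_kernel "torus_unif d" "\<lambda>x y. \<Prod>i<d. circ_kernel t (x i) (y i)" "t ^ d"
    unfolding torus_unif_def by (rule latent_kernel.latent_kernel_power[OF latent_kernel_circ[OF t]])
  let ?A = "{X \<in> space (latent_points n d). rgg_graph n d t X = E}"
  have ind: "T.graph_weight n E X = indicator ?A X" if "X \<in> space (latent_points n d)" for X
  proof (cases "rgg_graph n d t X = E")
    case True
    then have "T.graph_weight n E X = 1"
      unfolding T.graph_weight_def
      by (intro prod.neutral) (auto simp: prod_circ_kernel[OF t(1)] rgg_graph_def)
    then show ?thesis using True that by simp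
  next
    case False
    have "\<exists>e\<in>all_pairs n. (e \<in> E) \<noteq> (linf_dist d (X (fst e)) (X (snd e)) \<le> t)"
    proof (rule ccontr)
      assume "\<not> ?thesis"
      then have "rgg_graph n d t X = E" using E by (auto simp: rgg_graph_def graphs_def)
      then show False using False by simp
    qed
    then have "T.graph_weight n E X = 0"
      unfolding T.graph_weight_def
      by (subst prod_zero_iff) (auto simp: prod_circ_kernel[OF t(1)])
    then show ?thesis using False by simp
  qed
  have "rgg_prob n d p E = (\<integral>X. indicator ?A X \<partial>latent_points n d)"
    using d p by (simp add: rgg_prob_def tau_inf_eq t_def Int_absorb2 subset_eq)
  also have "\<dots> = (\<integral>X. T.graph_weight n E X \<partial>latent_points n d)"
    by (intro Bochner_Integration.integral_cong refl) (simp add: ind)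
  finally show ?thesis unfolding t_def[symmetric] T.graph_prob_def latent_points_def .
qed

section \<open>Convergence to the Erdos-Renyi graph\<close>

text \<open>R is the ratio assumed to diverge. The bounds n u \<le> 1 / R and n^2 u^3 d \<le> 1 /
  R^2 turn R \<ge> 4 into both smallness conditions of \<open>tv_latent_kernel_power_le\<close>. The
  constant is 192 = 32 * 6.\<close>

lemma tv_rgg_gnp_le:
  fixes n d :: nat and p R :: real
  assumes n: "n \<ge> 3" and p: "1 / real n \<le> p" "p \<le> 1 / 2" and R: "R \<ge> 4"
    and d: "R = real d / (max (real n powr (3/2) * p) (real n) * ln (real n) powr (3/2))"
  shows "tv_rgg_gnp n d p \<le> sqrt 192 / R"
proof -
  define L where "L = ln (real n)"
  \<comment> \<open>The exponent 3/2 makes K^2 = L^3, the logarithmic factor left by u \<le> L / d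
    in u^3 d.\<close>
  define K where "K = L powr (3/2)"
  define m where "m = max (real n powr (3/2) * p) (real n)"
  have n0: "real n > 0" using n by simp
  have p0: "p > 0" using less_le_trans[OF _ p(1), of 0] n0 by simp
  have L: "L \<ge> 1"
  proof -
    have "exp 1 \<le> real n" using exp_le n by linarith
    then show ?thesis using n0 by (simp add: L_def ln_ge_iff)
  qed
  have KL: "K \<ge> L" unfolding K_def using L powr_mono[of 1 "3/2" L] by simp
  have K2: "K\<^sup>2 = L ^ 3"
    unfolding K_def using L by (simp add: power2_eq_square flip: powr_add)
  have m: "m \<ge> real n" "m \<ge> real n powr (3/2) * p" by (auto simp: m_def)
  have pos: "m > 0" "K > 0" using m n0 L KL by auto
  then have mK: "m * K > 0" by simp
  have "R = real d / (m * K)" unfolding d m_def K_def L_def ..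
  then have dR: "real d = R * (m * K)" using pos by simp
  then have d0: "real d > 0" using R mK by simp
  then have d_pos: "d > 0" by simp
  have ratio: "x / real d \<le> 1 / R" if "x \<le> m * K" for x
  proof -
    have "x / real d \<le> m * K / real d" using that d0 by (intro divide_right_mono) auto
    also have "\<dots> = 1 / R" unfolding dR using pos R by simp
    finally show ?thesis .
  qed
  define t where "t = root d p"
  define u where "u = 1 - t"
  have t: "0 < t" "t \<le> 1" "t ^ d = p" using d_pos p0 p by (auto simp: t_def)
  have u0: "u \<ge> 0" using t by (simp add: u_def)
  \<comment> \<open>This is 1 - exp (-y) \<le> y with y = - ln p / d, together with p \<ge> 1 /
    n.\<close>
  have uL: "u \<le> L / real d"
  proof -
    have "- L = ln (1 / real n)" using n0 by (simp add: L_def ln_div)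
    also have "\<dots> \<le> ln p" using p n0 p0 by simp
    finally have "- L / real d \<le> ln p / real d" using d0 by (intro divide_right_mono) auto
    moreover have "t = exp (ln p / real d)"
    proof -
      have "t = exp (ln t)" using t by simp
      also have "ln t = ln p / real d" unfolding t_def using p0 d_pos by (simp add: ln_root)
      finally show ?thesis .
    qed
    then have "t \<ge> 1 + ln p / real d" by (metis exp_ge_add_one_self)
    ultimately show ?thesis by (simp add: u_def)
  qed
  have nu: "4 * real n * u \<le> 1"
  proof -
    have "real n * L \<le> m * K" using m KL L n0 by (intro mult_mono) auto
    from ratio[OF this] have "real n * L / real d \<le> 1 / R" .
    moreover have "real n * u \<le> real n * (L / real d)" using uL by (intro mult_left_mono) auto
    moreover have "1 / R \<le> 1 / 4" using R by simp
    ultimately show ?thesis by simp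
  qed
  have "1 * u \<le> real n * u" using n u0 by (intro mult_right_mono) auto
  then have u_half: "u \<le> 1 / 2" using nu by simp
  have u3d: "u ^ 3 * real d \<le> (K / real d)\<^sup>2"
  proof -
    have "u ^ 3 * real d \<le> (L / real d) ^ 3 * real d" using uL u0 by (intro mult_right_mono power_mono) auto
    also have "\<dots> = L ^ 3 / (real d)\<^sup>2" using d0 by (simp add: power_divide power2_eq_square power3_eq_cube)
    finally show ?thesis by (simp add: power_divide K2)
  qed
  \<comment> \<open>Applied once to each term of the maximum: x = n for the condition on the
    moments, x = n^(3/2) p for the final estimate.\<close>
  have bound: "x\<^sup>2 * (u ^ 3 * real d) \<le> 1 / R\<^sup>2" if "0 \<le> x" "x \<le> m" for x
  proof -
    have "x\<^sup>2 * (u ^ 3 * real d) \<le> x\<^sup>2 * (K / real d)\<^sup>2" using u3d by (intro mult_left_mono) auto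
    also have "\<dots> = (x * K / real d)\<^sup>2" by (simp add: power_mult_distrib power_divide)
    also have "\<dots> \<le> (1 / R)\<^sup>2"
      using that KL L d0 by (intro power_mono ratio mult_right_mono) auto
    finally show ?thesis by (simp add: power_divide)
  qed
  have n2: "16 * (real n)\<^sup>2 * u ^ 3 * real d \<le> 1"
  proof -
    have "(real n)\<^sup>2 * (u ^ 3 * real d) \<le> 1 / R\<^sup>2" using m by (intro bound) auto
    also have "\<dots> \<le> 1 / 4\<^sup>2" using R by (intro divide_left_mono power_mono) auto
    finally show ?thesis by (simp add: mult.assoc)
  qed
  define q where "q = p / (1 - p)"
  have q: "0 \<le> q" "q \<le> 2 * p"
  proof -
    show "0 \<le> q" using p p0 by (simp add: q_def)
    have "p * (2 * p) \<le> p * 1" using p p0 by (intro mult_left_mono) auto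
    then show "q \<le> 2 * p" using p by (simp add: q_def divide_le_eq algebra_simps)
  qed
  have np: "1 \<le> real n * p" using p(1) n0 by (simp add: field_simps)
  \<comment> \<open>As n p \<ge> 1, the linear term is at most 2 (n p)^2, and the quadratic one is
    at most 4 (n p)^2.\<close>
  have q_sum: "real n * q + (real n)\<^sup>2 * q\<^sup>2 \<le> 6 * (real n * p)\<^sup>2"
  proof -
    have 1: "real n * q \<le> 2 * (real n * p)" using q n0 by simp
    then have "(real n * q)\<^sup>2 \<le> (2 * (real n * p))\<^sup>2" using q by (intro power_mono) auto
    moreover have "(real n * p) * 1 \<le> (real n * p) * (real n * p)" using np by (intro mult_left_mono) auto
    ultimately show ?thesis using 1 by (simp add: power2_eq_square algebra_simps)
  qed
  have "real n * (32 * (real n * q + (real n)\<^sup>2 * q\<^sup>2) * u ^ 3 * real d) \<le>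
      real n * (32 * (6 * (real n * p)\<^sup>2) * (u ^ 3 * real d))"
  proof -
    have "32 * (real n * q + (real n)\<^sup>2 * q\<^sup>2) * (u ^ 3 * real d) \<le>
        32 * (6 * (real n * p)\<^sup>2) * (u ^ 3 * real d)"
      using q_sum u0 by (intro mult_right_mono mult_left_mono) auto
    then show ?thesis using n0 by (intro mult_left_mono) (auto simp: mult.assoc)
  qed
  also have "\<dots> = 192 * ((real n powr (3/2) * p)\<^sup>2 * (u ^ 3 * real d))"
  proof -
    have "(real n powr (3/2))\<^sup>2 = real n ^ 3"
      using n0 by (simp add: power2_eq_square flip: powr_add)
    then show ?thesis by (simp add: power_mult_distrib power2_eq_square power3_eq_cube)
  qed
  also have "\<dots> \<le> 192 * (1 / R\<^sup>2)"
    using m p0 by (intro mult_left_mono bound) auto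
  finally have final: "real n * (32 * (real n * q + (real n)\<^sup>2 * q\<^sup>2) * u ^ 3 * real d) \<le> 192 / R\<^sup>2" by simp
  interpret latent_kernel circle_unif "circ_kernel t" t
    using t by (intro latent_kernel_circ) auto
  have "tv_rgg_gnp n d p = tv_fin (graphs n)
      (latent_kernel.graph_prob (torus_unif d) (\<lambda>x y. \<Prod>i<d. circ_kernel t (x i) (y i)) n) (gnp_prob n (t ^ d))"
    unfolding tv_rgg_gnp_def tv_fin_def t(3) unfolding t_def
    using p p0 d_pos by (simp add: rgg_prob_eq_graph_prob cong: sum.cong)
  also have "\<dots> \<le> sqrt (real n * (32 * (real n * q + (real n)\<^sup>2 * q\<^sup>2) * u ^ 3 * real d))"
    unfolding torus_unif_def q_def t(3)[symmetric]
    using t p by (intro tv_latent_kernel_power_le u_def u_half nu n2) auto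
  also have "\<dots> \<le> sqrt (192 / R\<^sup>2)" by (rule real_sqrt_le_mono[OF final])
  also have "\<dots> = sqrt 192 / R" using R by (simp add: real_sqrt_divide)
  finally show ?thesis .
qed

text \<open>The polylogarithmic factor in the growth condition is a power C of ln n, fixed before
  the sequences p and d are chosen; C = 3/2 works for all \<delta> and \<epsilon>.\<close>

theorem theorem1p2:
  shows "\<forall>\<delta>>0. \<forall>\<epsilon>>0. \<exists>C::real. \<forall>(p :: nat \<Rightarrow> real) (d :: nat \<Rightarrow> nat).
     ((\<forall>\<^sub>F n in sequentially.
         real n powr (-1 + \<epsilon>) \<le> p n \<and> p n \<le> 1/2 \<and> real n powr \<delta> \<le> real (d n))
      \<and> filterlim (\<lambda>n. real (d n) /
            (max (real n powr (3/2) * p n) (real n) * ln (real n) powr C)) at_top sequentially)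
     \<longrightarrow> ((\<lambda>n. tv_rgg_gnp n (d n) (p n)) \<longlonglongrightarrow> 0)"
proof (intro allI impI exI[of _ "3/2"], elim conjE)
  fix \<delta> \<epsilon> :: real and p :: "nat \<Rightarrow> real" and d :: "nat \<Rightarrow> nat"
  assume eps: "\<epsilon> > 0"
    and A: "\<forall>\<^sub>F n in sequentially.
      real n powr (-1 + \<epsilon>) \<le> p n \<and> p n \<le> 1/2 \<and> real n powr \<delta> \<le> real (d n)"
  define R where "R = (\<lambda>n. real (d n) /
      (max (real n powr (3/2) * p n) (real n) * ln (real n) powr (3/2)))"
  assume "filterlim (\<lambda>n. real (d n) /
      (max (real n powr (3/2) * p n) (real n) * ln (real n) powr (3/2))) at_top sequentially"
  then have R: "filterlim R at_top sequentially" by (simp add: R_def)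
  have upper: "\<forall>\<^sub>F n in sequentially. tv_rgg_gnp n (d n) (p n) \<le> sqrt 192 / R n"
    using A filterlim_at_top[THEN iffD1, OF R, rule_format, of 4] eventually_ge_at_top[of 3]
  proof eventually_elim
    case (elim n)
    have "1 / real n = real n powr (- 1)" using elim by (simp add: powr_minus_divide)
    also have "\<dots> \<le> real n powr (-1 + \<epsilon>)" using elim eps by (intro powr_mono) auto
    finally have "1 / real n \<le> p n" using elim by simp
    then show ?case using elim by (intro tv_rgg_gnp_le) (auto simp: R_def)
  qed
  have lower: "\<forall>\<^sub>F n in sequentially. 0 \<le> tv_rgg_gnp n (d n) (p n)"
    by (simp add: tv_rgg_gnp_def tv_fin_def sum_nonneg)
  have "(\<lambda>n. sqrt 192 / R n) \<longlonglongrightarrow> 0"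
    by (rule real_tendsto_divide_at_top[OF tendsto_const R])
  then show "(\<lambda>n. tv_rgg_gnp n (d n) (p n)) \<longlonglongrightarrow> 0"
    by (rule tendsto_sandwich[OF lower upper tendsto_const])
qed

end
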